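(* Consider the sparse linear regression setting with $\beta\sim\mathcal{P}_{\|\beta\|_2}(\mathcal{D})$. Let $\epsilon\in(0,1)$ be the parameter used in CORR. Then for $$n\;\ge\;\frac{8(1+\epsilon)}{\beta_{\min}^2}\,\|\beta\|_2^2\,\frac{\mathrm{SNR}+1}{\mathrm{SNR}}\,\log(2p),$$ CORR solves strong detection in SLR-D.
   Context: **Scaling regime.** $p\to\infty$, $n\to\infty$, $k=o(p)$, $n=\omega(k)$. **Signal prior.** For $\mathcal{D}\subseteq\mathbb{R}$, $\beta\sim\mathcal{P}_{\|\beta\|_2}(\mathcal{D})$ means that $\beta$ is uniform over $k$-sparse vectors of $\mathbb{R}^p$ (exactly $k$ nonzero entries) whose nonzero entries lie in $\mathcal{D}$ and which have a fixed Euclidean norm, denoted $\|\beta\|_2$. It is assumed that $\beta_{\min}:=\min\{|b|:b\in\mathcal{D}\}>0$. $\mathrm{SNR}:=\|\beta\|_2^2/\sigma^2$. **Detection problem SLR-D.** Let $\sigma>0$; $X\in\mathbb{R}^{n\times p}$ has i.i.d. $\mathcal{N}(0,1)$ entries, $w\in\mathbb{R}^n$ has i.i.d. $\mathcal{N}(0,1)$ entries, $\beta\sim\mathcal{P}_{\|\beta\|_2}(\mathcal{D})$, all independent. One observes $(X,y)$ and must distinguish the null: $y=\sqrt{\|\beta\|_2^2/\sigma^2+1}\;w$, from the alternative: $y=\frac1\sigma X\beta+w$. **Strong detection:** the test succeeds with probability $1-o(1)$ as $p\to\infty$ under both hypotheses. **CORR.** With $X_j$ the $j$-th column of $X$ and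 $\tau=\sqrt{2(1+\epsilon/2)\log(2p)}$, CORR outputs the set $\{j\in[p]:\ |\langle X_j,y\rangle|/\|y\|_2\ge\tau\}$. As a test, CORR declares the alternative if this set is nonempty and the null otherwise. *)

theory Defs
  imports "HOL-Probability.Probability" "HOL-Library.Landau_Symbols"
begin

text \<open>
  The dimensions \<open>n\<close> and \<open>p\<close> vary with the asymptotics, so a vector of length \<open>p\<close> is a function
  in \<open>{..<p} \<rightarrow>\<^sub>E UNIV\<close>, and an \<open>n \<times> p\<close> matrix is a function on \<open>{..<n} \<times> {..<p}\<close>.
\<close>

abbreviation vec_space :: "'i set \<Rightarrow> ('i \<Rightarrow> real) measure" where
  "vec_space I \<equiv> PiM I (\<lambda>_. borel)"

definition std_gaussian :: "'i set \<Rightarrow> ('i \<Rightarrow> real) measure" where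
  "std_gaussian I = PiM I (\<lambda>_. density lborel std_normal_density)"


subsection \<open>Uniform distributions on subsets of Euclidean space\<close>

text \<open>
  The set of sparse vectors of given norm may be finite (finite entry alphabet), a union of
  pieces of spheres (alphabet containing intervals), or a mixture. In all cases the uniform
  distribution is the normalised Hausdorff measure \<open>\<H>\<^sup>s\<close>, where \<open>s\<close> is the dimension
  of the set: counting measure (\<open>s = 0\<close>) for a finite set, surface measure for pieces of spheres.
\<close>

definition ediam :: "nat \<Rightarrow> (nat \<Rightarrow> real) set \<Rightarrow> ennreal" where
  "ediam p U = (SUP x\<in>U. SUP y\<in>U. ennreal (L2_set (\<lambda>j. x j - y j) {..<p}))"

text \<open>
  The empty set has gauge \<open>0\<close> and \<open>0\<^sup>0 = 1\<close>, whereas \<open>0 powr 0 = 0\<close>. The conversion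
  \<open>enn2real\<close> is only applied to sets of finite diameter below.
\<close>

definition diam_gauge :: "nat \<Rightarrow> real \<Rightarrow> (nat \<Rightarrow> real) set \<Rightarrow> ennreal" where
  "diam_gauge p s U =
     (if U = {} then 0 else if s = 0 then 1 else ennreal (enn2real (ediam p U) powr s))"

definition hausdorff :: "nat \<Rightarrow> real \<Rightarrow> (nat \<Rightarrow> real) set \<Rightarrow> ennreal" where
  "hausdorff p s A =
     (SUP \<delta>\<in>{0<..}. INF U\<in>{U :: nat \<Rightarrow> (nat \<Rightarrow> real) set.
         A \<subseteq> (\<Union>i. U i) \<and> (\<forall>i. ediam p (U i) \<le> ennreal \<delta>)}. \<Sum>i. diam_gauge p s (U i))"

text \<open>
  At most one \<open>s\<close> satisfies \<open>0 < \<H>\<^sup>s(S) < \<infinity>\<close>, so the uniform distribution on \<open>S\<close> is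
  unique if it exists.
\<close>

definition uniform_on :: "nat \<Rightarrow> (nat \<Rightarrow> real) set \<Rightarrow> (nat \<Rightarrow> real) measure \<Rightarrow> bool" where
  "uniform_on p S P \<longleftrightarrow> sets P = sets (vec_space {..<p}) \<and>
     (\<exists>s\<ge>0. 0 < hausdorff p s S \<and> hausdorff p s S < \<infinity> \<and>
       (\<forall>A\<in>sets (vec_space {..<p}). emeasure P A = hausdorff p s (A \<inter> S) / hausdorff p s S))"

lemma ediam_singleton [simp]: "ediam p {x} = 0"
  by (simp add: ediam_def L2_set_def)

lemma hausdorff_finite_le:
  assumes "finite A"
  shows "hausdorff p s A \<le> (if s = 0 then of_nat (card A) else 0)"
proof -
  obtain f where f: "bij_betw f {..<card A} A"
    using ex_bij_betw_nat_finite[OF assms] by (auto simp: atLeast0LessThan)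
  define U where "U i = (if i < card A then {f i} else {})" for i
  have cov: "A \<subseteq> (\<Union>i. U i)"
  proof
    fix x assume "x \<in> A"
    then obtain i where "i < card A" "f i = x"
      using f by (force simp: bij_betw_def)
    then have "x \<in> U i" by (simp add: U_def)
    then show "x \<in> (\<Union>i. U i)" by blast
  qed
  have small: "ediam p (U i) \<le> ennreal \<delta>" for i and \<delta> :: real
    by (auto simp: U_def) (simp add: ediam_def)
  have "(\<Sum>i. diam_gauge p s (U i)) = (\<Sum>i<card A. diam_gauge p s (U i))"
    by (rule suminf_finite) (auto simp: U_def diam_gauge_def)
  also have "\<dots> = (if s = 0 then of_nat (card A) else 0)"
    by (auto simp: U_def diam_gauge_def)
  finally have sum: "(\<Sum>i. diam_gauge p s (U i)) = (if s = 0 then of_nat (card A) else 0)" .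
  show ?thesis
    unfolding hausdorff_def
  proof (rule SUP_least)
    fix \<delta> :: real assume "\<delta> \<in> {0<..}"
    show "(INF U\<in>{U. A \<subseteq> (\<Union>i. U i) \<and> (\<forall>i. ediam p (U i) \<le> ennreal \<delta>)}. \<Sum>i. diam_gauge p s (U i))
        \<le> (if s = 0 then of_nat (card A) else 0)"
      by (rule INF_lower2[of U]) (use cov small sum in auto)
  qed
qed

lemma hausdorff_0_finite_ge:
  assumes "finite A" and sub: "A \<subseteq> {..<p} \<rightarrow>\<^sub>E UNIV"
  shows "of_nat (card A) \<le> hausdorff p 0 A"
proof -
  let ?d = "\<lambda>x y. L2_set (\<lambda>j. x j - y j) {..<p}"
  have pos: "0 < ?d x y" if "x \<in> A" "y \<in> A" "x \<noteq> y" for x y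
  proof -
    have "\<exists>j\<in>{..<p}. x j \<noteq> y j"
      using that sub by (meson PiE_ext subsetD)
    then have "?d x y \<noteq> 0"
      by (subst L2_set_eq_0_iff) auto
    then show ?thesis
      using L2_set_nonneg[of "\<lambda>j. x j - y j" "{..<p}"] by linarith
  qed
  define D where "D = insert 1 ((\<lambda>(x, y). ?d x y) ` {(x, y)\<in>A \<times> A. x \<noteq> y})"
  have "finite {(x, y)\<in>A \<times> A. x \<noteq> y}"
    by (rule finite_subset[of _ "A \<times> A"]) (use assms in auto)
  then have finD: "finite D" and neD: "D \<noteq> {}"
    by (auto simp: D_def)
  define \<delta> where "\<delta> = Min D / 2"
  have "0 < Min D"
    using finD neD pos by (auto simp: D_def)
  then have \<delta>: "0 < \<delta>" "\<delta> < Min D" by (auto simp: \<delta>_def)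
  have sep: "\<delta> < ?d x y" if "x \<in> A" "y \<in> A" "x \<noteq> y" for x y
  proof -
    have "?d x y \<in> D" using that by (auto simp: D_def)
    then have "Min D \<le> ?d x y" using finD by (rule Min_le[rotated])
    then show ?thesis using \<delta>(2) by linarith
  qed
  have "of_nat (card A) \<le> (\<Sum>i. diam_gauge p 0 (U i))"
    if cov: "A \<subseteq> (\<Union>i. U i)" and small: "\<forall>i. ediam p (U i) \<le> ennreal \<delta>" for U :: "nat \<Rightarrow> _"
  proof -
    obtain f where f: "\<And>x. x \<in> A \<Longrightarrow> x \<in> U (f x)"
      using cov by (metis UN_E subsetD)
    have "inj_on f A"
    proof (rule inj_onI, rule ccontr)
      fix x y assume xy: "x \<in> A" "y \<in> A" "f x = f y" "x \<noteq> y"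
      have inU: "x \<in> U (f x)" "y \<in> U (f x)"
        using f[OF xy(1)] f[OF xy(2)] by (simp_all only: xy(3))
      have "ennreal (?d x y) \<le> (SUP z\<in>U (f x). ennreal (?d x z))"
        by (rule SUP_upper) (rule inU)
      also have "\<dots> \<le> ediam p (U (f x))"
        unfolding ediam_def by (rule SUP_upper) (rule inU)
      finally have "ennreal (?d x y) \<le> ediam p (U (f x))" .
      then have "ennreal (?d x y) \<le> ennreal \<delta>"
        using small order_trans by blast
      then show False
        using sep[OF xy(1,2,4)] \<delta>(1) by (simp add: ennreal_le_iff)
    qed
    then have "of_nat (card A) = (\<Sum>i\<in>f ` A. 1 :: ennreal)"
      by (simp add: card_image)
    also have "\<dots> \<le> (\<Sum>i\<in>f ` A. diam_gauge p 0 (U i))"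
      by (rule sum_mono) (use f in \<open>auto simp: diam_gauge_def\<close>)
    also have "\<dots> \<le> (\<Sum>i. diam_gauge p 0 (U i))"
      by (rule sum_le_suminf) (use assms(1) in auto)
    finally show ?thesis .
  qed
  then have "of_nat (card A) \<le> (INF U\<in>{U :: nat \<Rightarrow> (nat \<Rightarrow> real) set. A \<subseteq> (\<Union>i. U i) \<and>
      (\<forall>i. ediam p (U i) \<le> ennreal \<delta>)}. \<Sum>i. diam_gauge p 0 (U i))"
    by (intro INF_greatest) auto
  also have "\<dots> \<le> hausdorff p 0 A"
    unfolding hausdorff_def by (rule SUP_upper) (use \<delta> in auto)
  finally show ?thesis .
qed

lemma uniform_on_finite_iff:
  assumes "finite S" "S \<noteq> {}" and sub: "S \<subseteq> {..<p} \<rightarrow>\<^sub>E UNIV"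
  shows "uniform_on p S P \<longleftrightarrow> sets P = sets (vec_space {..<p}) \<and>
    (\<forall>A\<in>sets (vec_space {..<p}). emeasure P A = of_nat (card (A \<inter> S)) / of_nat (card S))"
proof -
  have H0: "hausdorff p 0 B = of_nat (card B)" if "B \<subseteq> S" for B
  proof (rule antisym)
    have "finite B" "B \<subseteq> {..<p} \<rightarrow>\<^sub>E UNIV"
      using that assms(1) sub by (auto intro: finite_subset)
    then show "hausdorff p 0 B \<le> of_nat (card B)" "of_nat (card B) \<le> hausdorff p 0 B"
      using hausdorff_finite_le[of B p 0] hausdorff_0_finite_ge[of B p] by simp_all
  qed
  have Hs: "hausdorff p s S = 0" if "s \<noteq> 0" for s
    using hausdorff_finite_le[OF assms(1), of p s] that by simp
  have "0 < card S" using assms by (simp add: card_gt_0_iff)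
  then have H0S: "0 < hausdorff p 0 S" "hausdorff p 0 S < \<infinity>"
    by (simp_all add: H0 of_nat_less_top)
  have "(\<exists>s\<ge>0. 0 < hausdorff p s S \<and> hausdorff p s S < \<infinity> \<and> Q s) \<longleftrightarrow> Q 0"
    for Q :: "real \<Rightarrow> bool"
  proof
    assume "\<exists>s\<ge>0. 0 < hausdorff p s S \<and> hausdorff p s S < \<infinity> \<and> Q s"
    then obtain s where s: "0 < hausdorff p s S" "Q s" by blast
    then have "s = 0" using Hs[of s] by (cases "s = 0") simp_all
    then show "Q 0" using s(2) by simp
  next
    assume "Q 0"
    then show "\<exists>s\<ge>0. 0 < hausdorff p s S \<and> hausdorff p s S < \<infinity> \<and> Q s"
      using H0S by (intro exI[of _ 0]) simp
  qed
  then show ?thesis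
    by (simp add: uniform_on_def H0)
qed


subsection \<open>Sparse linear regression\<close>

definition sparse_vectors :: "nat \<Rightarrow> nat \<Rightarrow> real set \<Rightarrow> real \<Rightarrow> (nat \<Rightarrow> real) set" where
  "sparse_vectors p k D r =
     {\<beta> \<in> {..<p} \<rightarrow>\<^sub>E UNIV. card {j\<in>{..<p}. \<beta> j \<noteq> 0} = k \<and>
        (\<forall>j<p. \<beta> j \<noteq> 0 \<longrightarrow> \<beta> j \<in> D) \<and> L2_set \<beta> {..<p} = r}"

text \<open>\<open>P\<close> is the prior \<open>\<P>\<^sub>r(D)\<close>, where \<open>r\<close> is the fixed norm of the signal.\<close>

definition signal_prior :: "nat \<Rightarrow> nat \<Rightarrow> real set \<Rightarrow> real \<Rightarrow> (nat \<Rightarrow> real) measure \<Rightarrow> bool" where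
  "signal_prior p k D r P \<longleftrightarrow> uniform_on p (sparse_vectors p k D r) P"

definition beta_min :: "real set \<Rightarrow> real" where
  "beta_min D = Inf (abs ` D)"

definition SNR :: "real \<Rightarrow> real \<Rightarrow> real" where
  "SNR r \<sigma> = r\<^sup>2 / \<sigma>\<^sup>2"

type_synonym observation = "(nat \<times> nat \<Rightarrow> real) \<times> (nat \<Rightarrow> real)"

text \<open>The laws of the observation \<open>(X, y)\<close> under the two hypotheses.\<close>

definition slr_null :: "nat \<Rightarrow> nat \<Rightarrow> real \<Rightarrow> real \<Rightarrow> observation measure" where
  "slr_null n p r \<sigma> =
     distr (std_gaussian ({..<n} \<times> {..<p}) \<Otimes>\<^sub>M std_gaussian {..<n})
       (vec_space ({..<n} \<times> {..<p}) \<Otimes>\<^sub>M vec_space {..<n})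
       (\<lambda>(X, w). (X, \<lambda>i\<in>{..<n}. sqrt (r\<^sup>2 / \<sigma>\<^sup>2 + 1) * w i))"

definition slr_alt :: "nat \<Rightarrow> nat \<Rightarrow> real \<Rightarrow> (nat \<Rightarrow> real) measure \<Rightarrow> observation measure" where
  "slr_alt n p \<sigma> P =
     distr (P \<Otimes>\<^sub>M std_gaussian ({..<n} \<times> {..<p}) \<Otimes>\<^sub>M std_gaussian {..<n})
       (vec_space ({..<n} \<times> {..<p}) \<Otimes>\<^sub>M vec_space {..<n})
       (\<lambda>(\<beta>, X, w). (X, \<lambda>i\<in>{..<n}. 1 / \<sigma> * (\<Sum>j<p. X (i, j) * \<beta> j) + w i))"

text \<open>A test maps an observation to \<open>True\<close> if it declares the alternative.\<close>

definition strong_detection ::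
    "(nat \<Rightarrow> 'a measure) \<Rightarrow> (nat \<Rightarrow> 'a measure) \<Rightarrow> (nat \<Rightarrow> 'a \<Rightarrow> bool) \<Rightarrow> bool" where
  "strong_detection Q0 Q1 T \<longleftrightarrow>
     (\<lambda>p. measure (Q0 p) {z \<in> space (Q0 p). \<not> T p z}) \<longlonglongrightarrow> 1 \<and>
     (\<lambda>p. measure (Q1 p) {z \<in> space (Q1 p). T p z}) \<longlonglongrightarrow> 1"

definition corr_threshold :: "real \<Rightarrow> nat \<Rightarrow> real" where
  "corr_threshold \<epsilon> p = sqrt (2 * (1 + \<epsilon> / 2) * ln (2 * real p))"

definition CORR :: "real \<Rightarrow> nat \<Rightarrow> nat \<Rightarrow> observation \<Rightarrow> nat set" where
  "CORR \<epsilon> n p = (\<lambda>(X, y).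
     {j\<in>{..<p}. \<bar>\<Sum>i<n. X (i, j) * y i\<bar> / L2_set y {..<n} \<ge> corr_threshold \<epsilon> p})"

definition CORR_test :: "real \<Rightarrow> nat \<Rightarrow> nat \<Rightarrow> observation \<Rightarrow> bool" where
  "CORR_test \<epsilon> n p z \<longleftrightarrow> CORR \<epsilon> n p z \<noteq> {}"

end

theory Submission
  imports Defs "HOL-Real_Asymp.Real_Asymp"
begin

text \<open>
  Under the null, \<open>y\<close> is independent of \<open>X\<close>, so for fixed \<open>y \<noteq> 0\<close> each \<open>\<langle>X\<^sub>j, y\<rangle> / \<parallel>y\<parallel>\<close> is standard
  normal, and a union bound over the \<open>p\<close> columns gives a false alarm probability of at most
  \<open>2 p exp (- \<tau>\<^sup>2 / 2) = (2 p) powr (- \<epsilon> / 2)\<close>.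

  Under the alternative, fix \<open>\<beta>\<close> and one column \<open>l\<close> of its support. With \<open>v = SNR + 1\<close>,
  \<open>\<langle>X\<^sub>l, y\<rangle>\<close> and \<open>\<parallel>y\<parallel>\<^sup>2\<close> are sums of \<open>n\<close> independent terms of means \<open>\<beta>\<^sub>l / \<sigma>\<close> and \<open>v\<close>
  and of second moments at most \<open>3 v\<close> and \<open>3 v\<^sup>2\<close>. By Chebyshev,
  \<open>\<bar>\<langle>X\<^sub>l, y\<rangle>\<bar> \<ge> 3/4 n \<bar>\<beta>\<^sub>l\<bar> / \<sigma>\<close> and \<open>\<parallel>y\<parallel>\<^sup>2 \<le> 2 n v\<close> with high probability, and the lower bound
  on \<open>n\<close> makes the quotient exceed \<open>\<tau>\<close>. A single column suffices for detection.
\<close>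

subsection \<open>Gaussian vectors\<close>

lemma prob_space_std_gaussian: "prob_space (std_gaussian I)"
  unfolding std_gaussian_def by (intro prob_space_PiM prob_space_normal_density) simp

lemma sets_std_gaussian [measurable_cong]: "sets (std_gaussian I) = sets (vec_space I)"
  unfolding std_gaussian_def by (intro sets_PiM_cong) auto

lemma space_std_gaussian: "space (std_gaussian I) = I \<rightarrow>\<^sub>E UNIV"
  by (simp add: std_gaussian_def space_PiM)

lemma distributed_std_gaussian:
  assumes "i \<in> I"
  shows "distributed (std_gaussian I) lborel (\<lambda>x. x i) std_normal_density"
proof -
  have "distr (std_gaussian I) lborel (\<lambda>x. x i) =
      distr (PiM I (\<lambda>_. density lborel std_normal_density)) (density lborel std_normal_density) (\<lambda>x. x i)"
    unfolding std_gaussian_def by (intro distr_cong) auto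
  also have "\<dots> = density lborel std_normal_density"
    by (intro distr_PiM_component prob_space_normal_density assms) simp
  finally show ?thesis
    using assms unfolding distributed_def by (auto intro!: measurable_component_singleton)
qed

lemma indep_vars_std_gaussian:
  "prob_space.indep_vars (std_gaussian I) (\<lambda>_. borel) (\<lambda>i x. x i) I"
proof -
  interpret prob_space "std_gaussian I" by (rule prob_space_std_gaussian)
  show ?thesis
  \<comment> \<open>The criterion \<open>indep_vars_iff_distr_eq_PiM'\<close>, joint law equal to
    the product of the marginals, asks for a nonempty index set.\<close>
  proof (cases "I = {}")
    case True
    then show ?thesis unfolding indep_vars_def indep_sets_def by auto
  next
    case False
    have "distr (std_gaussian I) (vec_space I) (\<lambda>x. \<lambda>i\<in>I. x i) =
        distr (std_gaussian I) (std_gaussian I) (\<lambda>x. x)"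
      by (intro distr_cong) (auto simp: sets_std_gaussian space_std_gaussian)
    also have "\<dots> = PiM I (\<lambda>_. density lborel std_normal_density)"
      by (simp add: std_gaussian_def)
    also have "\<dots> = PiM I (\<lambda>i. distr (std_gaussian I) borel (\<lambda>x. x i))"
    proof (intro PiM_cong refl)
      fix i assume "i \<in> I"
      then have "density lborel std_normal_density = distr (std_gaussian I) lborel (\<lambda>x. x i)"
        using distributed_std_gaussian[of i I] by (simp add: distributed_def)
      also have "\<dots> = distr (std_gaussian I) borel (\<lambda>x. x i)"
        by (intro distr_cong) auto
      finally show "density lborel std_normal_density = distr (std_gaussian I) borel (\<lambda>x. x i)" .
    qed
    finally show ?thesis
      using False by (subst indep_vars_iff_distr_eq_PiM') auto
  qed
qed

section \<open>Laws, moments and tails of Gaussian linear combinations\<close>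

lemma (in prob_space) normal_linear_combination:
  fixes Z :: "'i \<Rightarrow> 'a \<Rightarrow> real"
  assumes "finite J" and indep: "indep_vars (\<lambda>_. borel) Z J"
    and normal: "\<And>j. j \<in> J \<Longrightarrow> distributed M lborel (Z j) std_normal_density"
    and pos: "0 < (\<Sum>j\<in>J. (c j)\<^sup>2)"
  shows "distributed M lborel (\<lambda>x. \<Sum>j\<in>J. c j * Z j x) (normal_density 0 (sqrt (\<Sum>j\<in>J. (c j)\<^sup>2)))"
proof -
  \<comment> \<open>\<open>sum_indep_normal\<close> wants a nonempty index set and positive standard
    deviations, so terms with zero coefficient are dropped first.\<close>
  let ?K = "{j \<in> J. c j \<noteq> 0}"
  have "distributed M lborel (\<lambda>x. \<Sum>j\<in>?K. c j * Z j x)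
      (normal_density (\<Sum>j\<in>?K. 0) (sqrt (\<Sum>j\<in>?K. \<bar>c j\<bar>\<^sup>2)))"
  proof (rule sum_indep_normal)
    show "finite ?K" using \<open>finite J\<close> by simp
    show "?K \<noteq> {}" using pos by (force intro: ccontr)
    show "indep_vars (\<lambda>_. borel) (\<lambda>j x. c j * Z j x) ?K"
      by (rule indep_vars_compose2[OF indep_vars_subset[OF indep]]) auto
    fix j assume j: "j \<in> ?K"
    then show "0 < \<bar>c j\<bar>" by simp
    show "distributed M lborel (\<lambda>x. c j * Z j x) (normal_density 0 \<bar>c j\<bar>)"
      using normal_density_affine[OF normal, of j "c j" 0] j by simp
  qed
  moreover have "(\<Sum>j\<in>?K. f j) = (\<Sum>j\<in>J. f j)" if "\<And>j. c j = 0 \<Longrightarrow> f j = 0" for f :: "'i \<Rightarrow> real"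
    using \<open>finite J\<close> that by (intro sum.mono_neutral_left) auto
  ultimately show ?thesis by simp
qed

lemma (in prob_space) centered_normal_moments:
  assumes "0 < s" and X: "distributed M lborel X (normal_density 0 s)"
  shows "integrable M (\<lambda>x. X x ^ k)"
    and "expectation (\<lambda>x. (X x)\<^sup>2) = s\<^sup>2"
    and "expectation (\<lambda>x. X x ^ 4) = 3 * s ^ 4"
proof -
  show "integrable M (\<lambda>x. X x ^ k)"
    using integrable_normal_moment[OF \<open>0 < s\<close>, of 0 k]
      distributed_integrable[OF X, of "\<lambda>x. x ^ k"] by simp
  have "expectation (\<lambda>x. X x ^ k) = (\<integral>x. normal_density 0 s x * x ^ k \<partial>lborel)" for k
    using distributed_integral[OF X, of "\<lambda>x. x ^ k"] by simp
  \<comment> \<open>The even moments are \<open>fact (2 * j) / ((2 / s^2)^j * fact j)\<close>;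
    \<open>j = 1\<close> and \<open>j = 2\<close> give \<open>s^2\<close> and
    \<open>3 * s^4\<close>.\<close>
  from this[of 2] this[of 4]
  show "expectation (\<lambda>x. (X x)\<^sup>2) = s\<^sup>2" "expectation (\<lambda>x. X x ^ 4) = 3 * s ^ 4"
    using integral_normal_moment_even[OF \<open>0 < s\<close>, of 0 1]
      integral_normal_moment_even[OF \<open>0 < s\<close>, of 0 2]
    by (simp_all add: fact_numeral power_divide flip: power_mult)
qed

text \<open>Chernoff: \<open>\<phi>(x) \<le> \<phi>(x) exp (t (x - t)) = exp (- t\<^sup>2 / 2) \<phi>(x - t)\<close> for \<open>x \<ge> t \<ge> 0\<close>.\<close>

lemma std_normal_upper_tail:
  assumes "0 \<le> t"
  shows "emeasure (density lborel std_normal_density) {t..} \<le> ennreal (exp (- t\<^sup>2 / 2))"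
proof -
  have "emeasure (density lborel std_normal_density) {t..} =
      (\<integral>\<^sup>+x. ennreal (std_normal_density x) * indicator {t..} x \<partial>lborel)"
    by (simp add: emeasure_density)
  also have "\<dots> \<le> (\<integral>\<^sup>+x. ennreal (exp (- t\<^sup>2 / 2)) * ennreal (normal_density t 1 x) \<partial>lborel)"
  proof (intro nn_integral_mono)
    fix x :: real
    have "std_normal_density x \<le> exp (- t\<^sup>2 / 2) * normal_density t 1 x" if "t \<le> x"
    proof -
      have "0 \<le> t * (x - t)" using assms that by simp
      then have "- x\<^sup>2 / 2 \<le> - t\<^sup>2 / 2 + - (x - t)\<^sup>2 / 2"
        by (simp add: power2_eq_square field_simps)
      then have "exp (- x\<^sup>2 / 2) \<le> exp (- t\<^sup>2 / 2) * exp (- (x - t)\<^sup>2 / 2)"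
        by (simp flip: exp_add)
      then show ?thesis
        by (simp add: normal_density_def divide_right_mono)
    qed
    then show "ennreal (std_normal_density x) * indicator {t..} x
        \<le> ennreal (exp (- t\<^sup>2 / 2)) * ennreal (normal_density t 1 x)"
      by (auto simp: indicator_def ennreal_mult'[symmetric] intro!: ennreal_leI)
  qed
  also have "\<dots> = ennreal (exp (- t\<^sup>2 / 2)) * emeasure (density lborel (normal_density t 1)) UNIV"
    by (simp add: nn_integral_cmult emeasure_density)
  also have "\<dots> = ennreal (exp (- t\<^sup>2 / 2))"
    using prob_space.emeasure_space_1[OF prob_space_normal_density[of 1 t]] by simp
  finally show ?thesis .
qed

text \<open>Both \<open>X / s\<close> and \<open>- X / s\<close> are standard normal, so the
  one-sided bound applies twice; hence the factor 2.\<close>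

lemma (in prob_space) centered_normal_tail:
  assumes "0 < s" and X: "distributed M lborel X (normal_density 0 s)" and "0 \<le> t"
  shows "prob {x \<in> space M. t * s \<le> \<bar>X x\<bar>} \<le> 2 * exp (- t\<^sup>2 / 2)"
proof -
  have tail: "prob {x \<in> space M. t \<le> Y x} \<le> exp (- t\<^sup>2 / 2)"
    if Y: "distributed M lborel Y std_normal_density" for Y
  proof -
    have [measurable]: "Y \<in> borel_measurable M"
      using Y by (simp add: distributed_def)
    have "emeasure M {x \<in> space M. t \<le> Y x} = emeasure (distr M lborel Y) {t..}"
      by (subst emeasure_distr) (auto intro!: arg_cong[where f = "emeasure M"])
    also have "\<dots> \<le> ennreal (exp (- t\<^sup>2 / 2))"
      using Y std_normal_upper_tail[OF \<open>0 \<le> t\<close>] by (simp add: distributed_def)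
    finally show ?thesis
      by (simp add: emeasure_eq_measure)
  qed
  have [measurable]: "X \<in> borel_measurable M"
    using X by (simp add: distributed_def)
  \<comment> \<open>The summand \<open>0 +\<close> keeps the shape in which
    \<open>normal_density_affine\<close> gives the law of an affine image.\<close>
  have "{x \<in> space M. t * s \<le> \<bar>X x\<bar>} =
      {x \<in> space M. t \<le> 0 + 1 / s * X x} \<union> {x \<in> space M. t \<le> 0 + - 1 / s * X x}"
    using \<open>0 < s\<close> by (auto simp: field_simps abs_if split: if_splits)
  then have "prob {x \<in> space M. t * s \<le> \<bar>X x\<bar>}
      \<le> prob {x \<in> space M. t \<le> 0 + 1 / s * X x} + prob {x \<in> space M. t \<le> 0 + - 1 / s * X x}"
    by (simp add: measure_Un_le)
  also have "\<dots> \<le> exp (- t\<^sup>2 / 2) + exp (- t\<^sup>2 / 2)"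
    using normal_density_affine[OF X \<open>0 < s\<close>, of "1 / s" 0]
      normal_density_affine[OF X \<open>0 < s\<close>, of "- 1 / s" 0] \<open>0 < s\<close>
    by (intro add_mono tail) simp_all
  finally show ?thesis by simp
qed

subsection \<open>Second moment bounds\<close>

text \<open>Pythagoras: the new term is independent of the partial sum and centered, so the cross
  term integrates to 0. Integrability is part of the induction claim because additivity of the
  integral depends on it.\<close>

lemma (in prob_space) second_moment_sum_centered:
  fixes A :: "'i \<Rightarrow> 'a \<Rightarrow> real"
  assumes "finite I" and "indep_vars (\<lambda>_. borel) A I"
    and "\<And>i. i \<in> I \<Longrightarrow> integrable M (\<lambda>x. (A i x)\<^sup>2)"
    and "\<And>i. i \<in> I \<Longrightarrow> expectation (A i) = 0"
  shows "integrable M (\<lambda>x. (\<Sum>i\<in>I. A i x)\<^sup>2) \<and>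
    expectation (\<lambda>x. (\<Sum>i\<in>I. A i x)\<^sup>2) = (\<Sum>i\<in>I. expectation (\<lambda>x. (A i x)\<^sup>2))"
  using assms
proof (induction I rule: finite_induct)
  case empty
  then show ?case by simp
next
  case (insert i I)
  let ?S = "\<lambda>x. \<Sum>i\<in>I. A i x"
  have rv [measurable]: "A j \<in> borel_measurable M" if "j \<in> insert i I" for j
    using insert.prems(1) that unfolding indep_vars_def by auto
  have int: "integrable M (A j)" if "j \<in> insert i I" for j
    using square_integrable_imp_integrable[OF rv[OF that] insert.prems(2)[OF that]] .
  have IH: "integrable M (\<lambda>x. (?S x)\<^sup>2)"
    "expectation (\<lambda>x. (?S x)\<^sup>2) = (\<Sum>i\<in>I. expectation (\<lambda>x. (A i x)\<^sup>2))"
    using insert.IH[OF indep_vars_subset[OF insert.prems(1)]] insert.prems by auto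
  have intS: "integrable M ?S"
    using int by (intro Bochner_Integration.integrable_sum) auto
  have indep: "indep_var borel (A i) borel ?S"
    using insert by (intro indep_vars_sum) auto
  have prod: "integrable M (\<lambda>x. A i x * ?S x)" "expectation (\<lambda>x. A i x * ?S x) = 0"
    using indep_var_integrable[OF indep _ intS] indep_var_lebesgue_integral[OF indep _ intS]
      int[of i] insert.prems(3)[of i] by auto
  have eq: "(\<Sum>j\<in>insert i I. A j x)\<^sup>2 = (A i x)\<^sup>2 + 2 * (A i x * ?S x) + (?S x)\<^sup>2" for x
    using insert.hyps by (simp add: power2_eq_square algebra_simps)
  show ?case
    unfolding eq using insert.hyps insert.prems(2)[of i] IH prod
    by (simp add: Bochner_Integration.integral_add)
qed

text \<open>Chebyshev after centering. Bounding each variance by the second moment \<open>V\<close>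
  spares the computation of variances.\<close>

lemma (in prob_space) weak_law_deviation:
  fixes A :: "'i \<Rightarrow> 'a \<Rightarrow> real" and a V t :: real
  assumes "finite I" and indep: "indep_vars (\<lambda>_. borel) A I"
    and sq: "\<And>i. i \<in> I \<Longrightarrow> integrable M (\<lambda>x. (A i x)\<^sup>2)"
    and mean: "\<And>i. i \<in> I \<Longrightarrow> expectation (A i) = a"
    and second: "\<And>i. i \<in> I \<Longrightarrow> expectation (\<lambda>x. (A i x)\<^sup>2) \<le> V"
    and "0 < t"
  shows "prob {x \<in> space M. t \<le> \<bar>(\<Sum>i\<in>I. A i x) - card I * a\<bar>} \<le> card I * V / t\<^sup>2"
proof -
  let ?B = "\<lambda>i x. A i x - a"
  have rv [measurable]: "A i \<in> borel_measurable M" if "i \<in> I" for i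
    using indep that unfolding indep_vars_def by auto
  have int: "integrable M (A i)" if "i \<in> I" for i
    using square_integrable_imp_integrable[OF rv[OF that] sq[OF that]] .
  have sqB: "integrable M (\<lambda>x. (?B i x)\<^sup>2)" "expectation (\<lambda>x. (?B i x)\<^sup>2) \<le> V" if "i \<in> I" for i
  proof -
    show "integrable M (\<lambda>x. (?B i x)\<^sup>2)"
      using int[OF that] sq[OF that] by (simp add: power2_diff)
    have "expectation (\<lambda>x. (?B i x)\<^sup>2) = expectation (\<lambda>x. (A i x)\<^sup>2) - a\<^sup>2"
      using variance_eq[OF int[OF that] sq[OF that]] mean[OF that] by simp
    then show "expectation (\<lambda>x. (?B i x)\<^sup>2) \<le> V"
      using second[OF that] by (smt (verit) zero_le_power2)
  qed
  have "indep_vars (\<lambda>_. borel) ?B I"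
    by (rule indep_vars_compose2[OF indep]) auto
  then have *: "integrable M (\<lambda>x. (\<Sum>i\<in>I. ?B i x)\<^sup>2)"
    "expectation (\<lambda>x. (\<Sum>i\<in>I. ?B i x)\<^sup>2) = (\<Sum>i\<in>I. expectation (\<lambda>x. (?B i x)\<^sup>2))"
    using second_moment_sum_centered[of I ?B] \<open>finite I\<close> sqB(1) mean int by (auto simp: prob_space)
  have [measurable]: "(\<lambda>x. \<Sum>i\<in>I. ?B i x) \<in> borel_measurable M"
    by (intro borel_measurable_sum) simp
  have "prob {x \<in> space M. t \<le> \<bar>\<Sum>i\<in>I. ?B i x\<bar>} \<le> expectation (\<lambda>x. (\<Sum>i\<in>I. ?B i x)\<^sup>2) / t\<^sup>2"
    using *(1) \<open>0 < t\<close> by (intro second_moment_method) auto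
  also have "\<dots> \<le> card I * V / t\<^sup>2"
    unfolding *(2) using sqB(2) by (intro divide_right_mono sum_bounded_above) auto
  finally show ?thesis
    by (simp add: sum_subtractf)
qed

text \<open>Derived from orthogonality rather than from the law of the sum, so that the zero
  coefficient vector is covered; the polarisation in the next lemma can produce it.\<close>

lemma (in prob_space) second_moment_linear_combination:
  fixes Z :: "'i \<Rightarrow> 'a \<Rightarrow> real"
  assumes "finite J" and indep: "indep_vars (\<lambda>_. borel) Z J"
    and normal: "\<And>j. j \<in> J \<Longrightarrow> distributed M lborel (Z j) std_normal_density"
  shows "integrable M (\<lambda>x. (\<Sum>j\<in>J. c j * Z j x)\<^sup>2)"
    and "expectation (\<lambda>x. (\<Sum>j\<in>J. c j * Z j x)\<^sup>2) = (\<Sum>j\<in>J. (c j)\<^sup>2)"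
proof -
  have sq: "integrable M (\<lambda>x. (Z j x)\<^sup>2)" "expectation (\<lambda>x. (Z j x)\<^sup>2) = 1" if "j \<in> J" for j
    using centered_normal_moments(1,2)[OF zero_less_one normal[OF that]] by simp_all
  have "indep_vars (\<lambda>_. borel) (\<lambda>j x. c j * Z j x) J"
    by (rule indep_vars_compose2[OF indep]) auto
  then have "integrable M (\<lambda>x. (\<Sum>j\<in>J. c j * Z j x)\<^sup>2) \<and>
      expectation (\<lambda>x. (\<Sum>j\<in>J. c j * Z j x)\<^sup>2) = (\<Sum>j\<in>J. expectation (\<lambda>x. (c j * Z j x)\<^sup>2))"
    using standard_normal_distributed_expectation[OF normal] sq(1)
    by (intro second_moment_sum_centered \<open>finite J\<close>) (simp_all add: power_mult_distrib)
  then show "integrable M (\<lambda>x. (\<Sum>j\<in>J. c j * Z j x)\<^sup>2)"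
    "expectation (\<lambda>x. (\<Sum>j\<in>J. c j * Z j x)\<^sup>2) = (\<Sum>j\<in>J. (c j)\<^sup>2)"
    using sq(2) by (simp_all add: power_mult_distrib)
qed

text \<open>Polarisation: with \<open>Y\<close> the sum,
  \<open>2 Z l Y = (Y + Z l)^2 - Y^2 - (Z l)^2\<close>, and \<open>Y + Z l\<close> is again a linear
  combination, with coefficients \<open>d\<close>. Only second moments of such combinations are
  needed.\<close>

lemma (in prob_space) covariance_linear_combination:
  fixes Z :: "'i \<Rightarrow> 'a \<Rightarrow> real"
  assumes fin: "finite J" and indep: "indep_vars (\<lambda>_. borel) Z J"
    and normal: "\<And>j. j \<in> J \<Longrightarrow> distributed M lborel (Z j) std_normal_density"
    and l: "l \<in> J"
  shows "expectation (\<lambda>x. Z l x * (\<Sum>j\<in>J. c j * Z j x)) = c l"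
proof -
  let ?Y = "\<lambda>x. \<Sum>j\<in>J. c j * Z j x"
  define d where "d = (\<lambda>j. c j + (if j = l then 1 else 0))"
  note second = second_moment_linear_combination[OF fin indep normal]
  have d: "(\<Sum>j\<in>J. d j * Z j x) = ?Y x + Z l x" for x
    using fin l unfolding d_def
    by (simp add: distrib_right sum.distrib if_distrib[of "\<lambda>u. u * _"] sum.delta' cong: if_cong)
  have sumd: "(\<Sum>j\<in>J. (d j)\<^sup>2) = (\<Sum>j\<in>J. (c j)\<^sup>2) + 2 * c l + 1"
  proof -
    have "(d j)\<^sup>2 = (c j)\<^sup>2 + (if j = l then 2 * c l + 1 else 0)" for j
      by (simp add: d_def power2_eq_square algebra_simps)
    then show ?thesis using fin l by (simp add: sum.distrib)
  qed
  have Zl: "integrable M (\<lambda>x. (Z l x)\<^sup>2)" "expectation (\<lambda>x. (Z l x)\<^sup>2) = 1"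
    using centered_normal_moments(1,2)[OF zero_less_one normal[OF l]] by simp_all
  have polar: "Z l x * ?Y x = ((?Y x + Z l x)\<^sup>2 - (?Y x)\<^sup>2 - (Z l x)\<^sup>2) / 2" for x
    by (simp add: power2_eq_square algebra_simps)
  show ?thesis
    unfolding polar using second[of d] second[of c] Zl by (simp add: d sumd)
qed

lemma (in prob_space) fourth_moment_linear_combination:
  fixes Z :: "'i \<Rightarrow> 'a \<Rightarrow> real"
  assumes fin: "finite J" and indep: "indep_vars (\<lambda>_. borel) Z J"
    and normal: "\<And>j. j \<in> J \<Longrightarrow> distributed M lborel (Z j) std_normal_density"
    and pos: "0 < (\<Sum>j\<in>J. (c j)\<^sup>2)"
  shows "integrable M (\<lambda>x. (\<Sum>j\<in>J. c j * Z j x) ^ 4)"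
    and "expectation (\<lambda>x. (\<Sum>j\<in>J. c j * Z j x) ^ 4) = 3 * (\<Sum>j\<in>J. (c j)\<^sup>2)\<^sup>2"
proof -
  let ?v = "\<Sum>j\<in>J. (c j)\<^sup>2"
  have "sqrt ?v ^ 4 = ?v\<^sup>2"
    using pos power_mult[of "sqrt ?v" 2 2] by simp
  then show "integrable M (\<lambda>x. (\<Sum>j\<in>J. c j * Z j x) ^ 4)"
    "expectation (\<lambda>x. (\<Sum>j\<in>J. c j * Z j x) ^ 4) = 3 * ?v\<^sup>2"
    using centered_normal_moments(1,3)[OF _ normal_linear_combination[OF fin indep normal pos]] pos
    by simp_all
qed

text \<open>Weighted AM-GM separates the two dependent factors:
  \<open>2 (Z l)^2 Y^2 <= v (Z l)^4 + Y^4 / v\<close>. The weight \<open>v\<close> balances the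
  terms on the right, each of mean \<open>3 v\<close>.\<close>

lemma (in prob_space) correlation_second_moment:
  fixes Z :: "'i \<Rightarrow> 'a \<Rightarrow> real"
  assumes fin: "finite J" and indep: "indep_vars (\<lambda>_. borel) Z J"
    and normal: "\<And>j. j \<in> J \<Longrightarrow> distributed M lborel (Z j) std_normal_density"
    and pos: "0 < (\<Sum>j\<in>J. (c j)\<^sup>2)" and l: "l \<in> J"
  shows "integrable M (\<lambda>x. (Z l x * (\<Sum>j\<in>J. c j * Z j x))\<^sup>2)"
    and "expectation (\<lambda>x. (Z l x * (\<Sum>j\<in>J. c j * Z j x))\<^sup>2) \<le> 3 * (\<Sum>j\<in>J. (c j)\<^sup>2)"
proof -
  let ?Y = "\<lambda>x. \<Sum>j\<in>J. c j * Z j x"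
  let ?v = "\<Sum>j\<in>J. (c j)\<^sup>2"
  let ?bound = "\<lambda>x. (?v * Z l x ^ 4 + ?Y x ^ 4 / ?v) / 2"
  have [measurable]: "Z j \<in> borel_measurable M" if "j \<in> J" for j
    using indep that unfolding indep_vars_def by auto
  have Z4: "integrable M (\<lambda>x. Z l x ^ 4)" "expectation (\<lambda>x. Z l x ^ 4) = 3"
    using centered_normal_moments(1,3)[OF zero_less_one normal[OF l]] by simp_all
  note Y4 = fourth_moment_linear_combination[OF fin indep normal pos]
  have le: "(Z l x * ?Y x)\<^sup>2 \<le> ?bound x" for x
  proof -
    have "0 \<le> (?v * (Z l x)\<^sup>2 - (?Y x)\<^sup>2)\<^sup>2 / ?v" using pos by simp
    also have "\<dots> = ?v * Z l x ^ 4 + ?Y x ^ 4 / ?v - 2 * (Z l x * ?Y x)\<^sup>2"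
      using pos by (simp add: field_simps power2_eq_square power4_eq_xxxx)
    finally show ?thesis by simp
  qed
  have int: "integrable M ?bound" using Z4 Y4 by simp
  show *: "integrable M (\<lambda>x. (Z l x * ?Y x)\<^sup>2)"
    by (rule Bochner_Integration.integrable_bound[OF int]) (use le l in \<open>auto intro: order_trans[OF _ abs_ge_self]\<close>)
  have "expectation (\<lambda>x. (Z l x * ?Y x)\<^sup>2) \<le> expectation ?bound"
    using le by (intro integral_mono * int)
  also have "\<dots> = 3 * ?v"
    using Z4 Y4 pos by (simp add: power2_eq_square)
  finally show "expectation (\<lambda>x. (Z l x * ?Y x)\<^sup>2) \<le> 3 * ?v" .
qed

text \<open>Chebyshev at deviation \<open>n v\<close> gives \<open>n 3 v^2 / (n v)^2 = 3 / n\<close>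
  for the energy, and at deviation \<open>n |c l| / 4\<close> it gives
  \<open>n 3 v / (n |c l| / 4)^2 = 48 v / (n (c l)^2)\<close> for the correlation. A union bound
  joins the two.\<close>

lemma (in prob_space) regression_concentration:
  fixes Z :: "'i \<times> 'j \<Rightarrow> 'a \<Rightarrow> real" and c :: "'j \<Rightarrow> real"
  assumes I: "finite I" "I \<noteq> {}" and fin: "finite J"
    and indep: "indep_vars (\<lambda>_. borel) Z (I \<times> J)"
    and normal: "\<And>k. k \<in> I \<times> J \<Longrightarrow> distributed M lborel (Z k) std_normal_density"
    and l: "l \<in> J" "c l \<noteq> 0"
  defines "Y \<equiv> \<lambda>i x. \<Sum>j\<in>J. c j * Z (i, j) x" and "v \<equiv> \<Sum>j\<in>J. (c j)\<^sup>2" and "n \<equiv> real (card I)"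
  shows "prob {x \<in> space M. n * v \<le> \<bar>(\<Sum>i\<in>I. (Y i x)\<^sup>2) - n * v\<bar> \<or>
      n * \<bar>c l\<bar> / 4 \<le> \<bar>(\<Sum>i\<in>I. Z (i, l) x * Y i x) - n * c l\<bar>} \<le> 3 / n + 48 * v / (n * (c l)\<^sup>2)"
proof -
  have n: "0 < n" using I by (simp add: n_def card_gt_0_iff)
  have v: "0 < v" unfolding v_def using fin l by (intro sum_pos2[of _ l]) auto
  have [measurable]: "Z k \<in> borel_measurable M" if "k \<in> I \<times> J" for k
    using indep that unfolding indep_vars_def by auto
  have Y_rv [measurable]: "Y i \<in> borel_measurable M" if "i \<in> I" for i
    unfolding Y_def using that by (intro borel_measurable_sum borel_measurable_times) auto
  have row: "indep_vars (\<lambda>_. borel) (\<lambda>j. Z (i, j)) J" if "i \<in> I" for i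
  proof -
    \<comment> \<open>Reindexing from pairs to \<open>j\<close>: the singleton blocks are disjoint,
      and evaluating a block at its only index returns \<open>Z (i, j)\<close>.\<close>
    have "indep_vars (\<lambda>j. PiM {(i, j)} (\<lambda>_. borel)) (\<lambda>j x. restrict (\<lambda>k. Z k x) {(i, j)}) J"
      using that by (intro indep_vars_restrict[OF indep]) (auto simp: disjoint_family_on_def)
    then have "indep_vars (\<lambda>_. borel) (\<lambda>j x. restrict (\<lambda>k. Z k x) {(i, j)} (i, j)) J"
      by (rule indep_vars_compose2) (auto intro!: measurable_component_singleton)
    then show ?thesis by simp
  qed
  have row_normal: "distributed M lborel (Z (i, j)) std_normal_density" if "i \<in> I" "j \<in> J" for i j
    using normal that by simp
  have rows: "indep_vars (\<lambda>_. borel) (\<lambda>i x. Z (i, l) x * Y i x) I"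
    "indep_vars (\<lambda>_. borel) (\<lambda>i x. (Y i x)\<^sup>2) I"
  proof -
    \<comment> \<open>Grouping by rows: disjoint blocks are independent, and the term of index
      \<open>i\<close> in both sums is a measurable function of row \<open>i\<close> alone.\<close>
    have K: "indep_vars (\<lambda>i. PiM ({i} \<times> J) (\<lambda>_. borel)) (\<lambda>i x. restrict (\<lambda>k. Z k x) ({i} \<times> J)) I"
      by (intro indep_vars_restrict[OF indep]) (auto simp: disjoint_family_on_def)
    have [measurable]: "(\<lambda>f. \<Sum>j\<in>J. c j * f (i, j)) \<in> borel_measurable (PiM ({i} \<times> J) (\<lambda>_. borel))" for i
      by (intro borel_measurable_sum borel_measurable_times borel_measurable_const
          measurable_component_singleton) auto
    have [measurable]: "(\<lambda>f. f (i, l)) \<in> borel_measurable (PiM ({i} \<times> J) (\<lambda>_. borel))" for i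
      using l by (intro measurable_component_singleton) auto
    show "indep_vars (\<lambda>_. borel) (\<lambda>i x. Z (i, l) x * Y i x) I"
      using indep_vars_compose2[OF K, of "\<lambda>i f. f (i, l) * (\<Sum>j\<in>J. c j * f (i, j))" "\<lambda>_. borel"] l
      by (simp add: Y_def)
    show "indep_vars (\<lambda>_. borel) (\<lambda>i x. (Y i x)\<^sup>2) I"
      using indep_vars_compose2[OF K, of "\<lambda>i f. (\<Sum>j\<in>J. c j * f (i, j))\<^sup>2" "\<lambda>_. borel"]
      by (simp add: Y_def)
  qed
  have "prob {x \<in> space M. n * v \<le> \<bar>(\<Sum>i\<in>I. (Y i x)\<^sup>2) - n * v\<bar>} \<le> n * (3 * v\<^sup>2) / (n * v)\<^sup>2"
    unfolding n_def
  proof (rule weak_law_deviation[OF \<open>finite I\<close> rows(2)])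
    fix i assume i: "i \<in> I"
    note mom = second_moment_linear_combination[OF fin row[OF i] row_normal[OF i], of c]
      fourth_moment_linear_combination[OF fin row[OF i] row_normal[OF i] v[unfolded v_def]]
    show "integrable M (\<lambda>x. ((Y i x)\<^sup>2)\<^sup>2)" "expectation (\<lambda>x. (Y i x)\<^sup>2) = v"
      "expectation (\<lambda>x. ((Y i x)\<^sup>2)\<^sup>2) \<le> 3 * v\<^sup>2"
      using mom by (simp_all add: Y_def v_def flip: power_mult)
  qed (use n v n_def in simp)
  also have "\<dots> = 3 / n"
    using n v by (simp add: field_simps power2_eq_square)
  finally have energy: "prob {x \<in> space M. n * v \<le> \<bar>(\<Sum>i\<in>I. (Y i x)\<^sup>2) - n * v\<bar>} \<le> 3 / n" .
  have "prob {x \<in> space M. n * \<bar>c l\<bar> / 4 \<le> \<bar>(\<Sum>i\<in>I. Z (i, l) x * Y i x) - n * c l\<bar>}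
      \<le> n * (3 * v) / (n * \<bar>c l\<bar> / 4)\<^sup>2"
    unfolding n_def
  proof (rule weak_law_deviation[OF \<open>finite I\<close> rows(1)])
    fix i assume i: "i \<in> I"
    note mom = covariance_linear_combination[OF fin row[OF i] row_normal[OF i] l(1), of c]
      correlation_second_moment[OF fin row[OF i] row_normal[OF i] v[unfolded v_def] l(1)]
    show "integrable M (\<lambda>x. (Z (i, l) x * Y i x)\<^sup>2)" "expectation (\<lambda>x. Z (i, l) x * Y i x) = c l"
      "expectation (\<lambda>x. (Z (i, l) x * Y i x)\<^sup>2) \<le> 3 * v"
      using mom by (simp_all add: Y_def v_def)
  qed (use n l n_def in simp)
  also have "\<dots> = 48 * v / (n * (c l)\<^sup>2)"
    using n l by (simp add: field_simps power2_eq_square)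
  finally have corr: "prob {x \<in> space M. n * \<bar>c l\<bar> / 4 \<le> \<bar>(\<Sum>i\<in>I. Z (i, l) x * Y i x) - n * c l\<bar>}
      \<le> 48 * v / (n * (c l)\<^sup>2)" .
  have [measurable]: "(\<lambda>x. \<Sum>i\<in>I. (Y i x)\<^sup>2) \<in> borel_measurable M"
    "(\<lambda>x. \<Sum>i\<in>I. Z (i, l) x * Y i x) \<in> borel_measurable M"
    using l by (auto intro!: borel_measurable_sum)
  let ?A = "{x \<in> space M. n * v \<le> \<bar>(\<Sum>i\<in>I. (Y i x)\<^sup>2) - n * v\<bar>}"
  let ?B = "{x \<in> space M. n * \<bar>c l\<bar> / 4 \<le> \<bar>(\<Sum>i\<in>I. Z (i, l) x * Y i x) - n * c l\<bar>}"
  have "prob (?A \<union> ?B) \<le> prob ?A + prob ?B"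
    by (intro measure_Un_le) auto
  also have "\<dots> \<le> 3 / n + 48 * v / (n * (c l)\<^sup>2)"
    by (intro add_mono energy corr)
  finally show ?thesis
    by (simp only: Collect_disj_eq[symmetric] conj_disj_distribL[symmetric])
qed

text \<open>The chain is \<open>t sqrt E <= t sqrt (2 n v) <= 3/4 n |a| <= |C|\<close>; the
  assumption \<open>32 t^2 v <= 9 n a^2\<close> is its middle inequality, squared and cleared of
  common factors.\<close>

lemma normalized_correlation_ge:
  fixes n v a C E t :: real
  assumes "0 < n" "0 < v" "a \<noteq> 0" "0 \<le> t" and t: "32 * t\<^sup>2 * v \<le> 9 * n * a\<^sup>2"
    and E: "\<bar>E - n * v\<bar> < n * v" and C: "\<bar>C - n * a\<bar> < n * \<bar>a\<bar> / 4"
  shows "t \<le> \<bar>C\<bar> / sqrt E"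
proof -
  \<comment> \<open>Strictness of the deviation bound makes \<open>E\<close> positive, so the final
    division by \<open>sqrt E\<close> is legitimate.\<close>
  have "0 < E" "E \<le> 2 * (n * v)" using E by auto
  have "(t * sqrt E)\<^sup>2 = t\<^sup>2 * E"
    using \<open>0 < E\<close> by (simp add: power_mult_distrib)
  also have "\<dots> \<le> t\<^sup>2 * (2 * (n * v))"
    using \<open>E \<le> 2 * (n * v)\<close> by (intro mult_left_mono) auto
  also have "\<dots> = n / 16 * (32 * t\<^sup>2 * v)" by simp
  also have "\<dots> \<le> n / 16 * (9 * n * a\<^sup>2)"
    using t \<open>0 < n\<close> by (intro mult_left_mono) auto
  also have "\<dots> = (3 / 4 * (n * \<bar>a\<bar>))\<^sup>2"
    by (simp add: power2_eq_square)
  finally have "t * sqrt E \<le> 3 / 4 * (n * \<bar>a\<bar>)"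
    by (rule power2_le_imp_le) (use \<open>0 < n\<close> in simp)
  also have "\<dots> \<le> \<bar>C\<bar>"
  proof -
    have "n * \<bar>a\<bar> = \<bar>n * a\<bar>" using \<open>0 < n\<close> by (simp add: abs_mult)
    then show ?thesis using C by linarith
  qed
  finally show ?thesis
    using \<open>0 < E\<close> by (simp add: field_simps)
qed

subsection \<open>CORR for a fixed response and for a fixed signal\<close>

text \<open>
  Appending the noise to the design as column \<open>p\<close> makes each response \<open>y\<^sub>i\<close> a linear combination
  of a single Gaussian row.
\<close>

lemma distr_design_noise:
  fixes n p :: nat
  shows "distr (std_gaussian ({..<n} \<times> {..<p}) \<Otimes>\<^sub>M std_gaussian {..<n}) (std_gaussian ({..<n} \<times> {..p}))
     (\<lambda>(X, w). \<lambda>k\<in>{..<n} \<times> {..p}. if snd k < p then X k else w (fst k)) =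
   std_gaussian ({..<n} \<times> {..p})"
  (is "distr (?GX \<Otimes>\<^sub>M ?Gw) _ ?f = _")
proof -
  let ?N = "density lborel std_normal_density"
  let ?K = "{..<n} \<times> {..p}"
  interpret N: prob_space ?N by (rule prob_space_normal_density) simp
  interpret PiN: product_sigma_finite "\<lambda>_. ?N" by standard
  interpret Gw: prob_space ?Gw by (rule prob_space_std_gaussian)
  have f: "?f \<in> measurable (?GX \<Otimes>\<^sub>M ?Gw) (PiM ?K (\<lambda>_. ?N))"
    unfolding split_beta'
  proof (intro measurable_restrict)
    fix k assume k: "k \<in> ?K"
    show "(\<lambda>x. if snd k < p then fst x k else snd x (fst k)) \<in> measurable (?GX \<Otimes>\<^sub>M ?Gw) ?N"
    proof (cases "snd k < p")
      case True
      then have "(\<lambda>X. X k) \<in> measurable ?GX ?N"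
        unfolding std_gaussian_def using k by (intro measurable_component_singleton) auto
      then show ?thesis using True measurable_compose[OF measurable_fst] by simp
    next
      case False
      have "(\<lambda>w. w (fst k)) \<in> measurable ?Gw ?N"
        unfolding std_gaussian_def using k by (intro measurable_component_singleton) auto
      then show ?thesis using False measurable_compose[OF measurable_snd] by simp
    qed
  qed
  have "distr (?GX \<Otimes>\<^sub>M ?Gw) (PiM ?K (\<lambda>_. ?N)) ?f = PiM ?K (\<lambda>_. ?N)"
  \<comment> \<open>A finite product measure is determined by its values on boxes. The preimage of a
    box splits into a box for the design and a box for the noise, given by the factors in column
    \<open>p\<close>.\<close>
  proof (rule PiN.PiM_eqI)
    fix A assume A: "\<And>k. k \<in> ?K \<Longrightarrow> A k \<in> sets ?N"
    let ?AX = "Pi\<^sub>E ({..<n} \<times> {..<p}) A" and ?Aw = "Pi\<^sub>E {..<n} (\<lambda>i. A (i, p))"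
    have "?f -` Pi\<^sub>E ?K A \<inter> space (?GX \<Otimes>\<^sub>M ?Gw) = ?AX \<times> ?Aw"
    proof (intro set_eqI iffI)
      fix x assume "x \<in> ?f -` Pi\<^sub>E ?K A \<inter> space (?GX \<Otimes>\<^sub>M ?Gw)"
      then have "?f x \<in> Pi\<^sub>E ?K A" and sp: "fst x \<in> ({..<n} \<times> {..<p}) \<rightarrow>\<^sub>E UNIV" "snd x \<in> {..<n} \<rightarrow>\<^sub>E UNIV"
        by (auto simp: space_pair_measure space_std_gaussian)
      then have x: "(if snd k < p then fst x k else snd x (fst k)) \<in> A k" if "k \<in> ?K" for k
        using PiE_mem[of "?f x" ?K A k] that by (simp add: split_beta')
      have "fst x k \<in> A k" if "k \<in> {..<n} \<times> {..<p}" for k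
        using x[of k] that by auto
      moreover have "snd x i \<in> A (i, p)" if "i < n" for i
        using x[of "(i, p)"] that by simp
      ultimately show "x \<in> ?AX \<times> ?Aw"
        using sp by (cases x) (auto simp: PiE_iff)
    next
      fix x assume "x \<in> ?AX \<times> ?Aw"
      then obtain X w where x: "x = (X, w)" and X: "X \<in> ?AX" and w: "w \<in> ?Aw" by blast
      have "(if snd k < p then X k else w (fst k)) \<in> A k" if k: "k \<in> ?K" for k
      proof (cases "snd k < p")
        case True
        then have "k \<in> {..<n} \<times> {..<p}" using k by auto
        then show ?thesis using True PiE_mem[OF X] by simp
      next
        case False
        then obtain i where "k = (i, p)" "i < n" using k by auto
        then show ?thesis using PiE_mem[OF w, of i] by simp
      qed
      then have "?f x \<in> Pi\<^sub>E ?K A"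
        unfolding x by (simp add: restrict_PiE_iff)
      moreover have "X \<in> space ?GX" "w \<in> space ?Gw"
        using X w by (simp_all add: space_std_gaussian PiE_iff)
      ultimately show "x \<in> ?f -` Pi\<^sub>E ?K A \<inter> space (?GX \<Otimes>\<^sub>M ?Gw)"
        by (simp add: x space_pair_measure)
    qed
    then have "emeasure (distr (?GX \<Otimes>\<^sub>M ?Gw) (PiM ?K (\<lambda>_. ?N)) ?f) (Pi\<^sub>E ?K A) =
        emeasure (?GX \<Otimes>\<^sub>M ?Gw) (?AX \<times> ?Aw)"
      using A by (subst emeasure_distr[OF f]) (auto intro!: sets_PiM_I_finite)
    also have "\<dots> = emeasure ?GX ?AX * emeasure ?Gw ?Aw"
      using A by (intro Gw.emeasure_pair_measure_Times)
        (auto simp: std_gaussian_def intro!: sets_PiM_I_finite)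
    also have "emeasure ?GX ?AX = (\<Prod>k\<in>{..<n} \<times> {..<p}. emeasure ?N (A k))"
      unfolding std_gaussian_def using A by (intro PiN.emeasure_PiM) auto
    also have "emeasure ?Gw ?Aw = (\<Prod>i<n. emeasure ?N (A (i, p)))"
      unfolding std_gaussian_def using A by (intro PiN.emeasure_PiM) auto
    \<comment> \<open>Reindexed so that both products run over matrix positions and merge over a
      disjoint union of columns.\<close>
    also have "\<dots> = (\<Prod>k\<in>{..<n} \<times> {p}. emeasure ?N (A k))"
    proof -
      have "{..<n} \<times> {p} = (\<lambda>i. (i, p)) ` {..<n}" by auto
      then show ?thesis by (simp add: prod.reindex inj_on_def)
    qed
    also have "(\<Prod>k\<in>{..<n} \<times> {..<p}. emeasure ?N (A k)) * \<dots> =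
        (\<Prod>k\<in>{..<n} \<times> {..<p} \<union> {..<n} \<times> {p}. emeasure ?N (A k))"
      by (subst prod.union_disjoint) auto
    also have "{..<n} \<times> {..<p} \<union> {..<n} \<times> {p} = ?K" by auto
    finally show "emeasure (distr (?GX \<Otimes>\<^sub>M ?Gw) (PiM ?K (\<lambda>_. ?N)) ?f) (Pi\<^sub>E ?K A) =
        (\<Prod>k\<in>?K. emeasure ?N (A k))" .
  qed simp_all
  then show ?thesis by (simp add: std_gaussian_def)
qed

lemma pred_CORR_test [measurable]:
  "Measurable.pred (vec_space ({..<n} \<times> {..<p}) \<Otimes>\<^sub>M vec_space {..<n}) (CORR_test \<epsilon> n p)"
proof -
  have [measurable]: "(\<lambda>z. fst z (i, j)) \<in> borel_measurable (vec_space ({..<n} \<times> {..<p}) \<Otimes>\<^sub>M vec_space {..<n})"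
    if "i < n" "j < p" for i j
    using that by (intro measurable_compose[OF measurable_fst] measurable_component_singleton) auto
  have [measurable]: "(\<lambda>z. snd z i) \<in> borel_measurable (vec_space ({..<n} \<times> {..<p}) \<Otimes>\<^sub>M vec_space {..<n})"
    if "i < n" for i
    using that by (intro measurable_compose[OF measurable_snd] measurable_component_singleton) auto
  \<comment> \<open>Nonemptiness of the output becomes a finite disjunction of comparisons of
    measurable functions.\<close>
  have "CORR_test \<epsilon> n p = (\<lambda>z. \<exists>j\<in>{..<p}. corr_threshold \<epsilon> p
      \<le> \<bar>\<Sum>i<n. fst z (i, j) * snd z i\<bar> / sqrt (\<Sum>i<n. (snd z i)\<^sup>2))"
    by (auto simp: fun_eq_iff CORR_test_def CORR_def L2_set_def)
  then show ?thesis
    by (simp only:) (intro pred_intros_finite finite_lessThan; measurable)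
qed

lemma CORR_test_fixed_response:
  assumes "0 < corr_threshold \<epsilon> p"
  shows "measure (std_gaussian ({..<n} \<times> {..<p})) {X \<in> space (std_gaussian ({..<n} \<times> {..<p})).
      CORR_test \<epsilon> n p (X, y)} \<le> real p * (2 * exp (- (corr_threshold \<epsilon> p)\<^sup>2 / 2))"
proof (cases "L2_set y {..<n} = 0")
  case True
  \<comment> \<open>Division by 0 yields 0, so for a response of zero norm every normalised
    correlation is 0 and stays below the positive threshold.\<close>
  then have empty: "{X \<in> space (std_gaussian ({..<n} \<times> {..<p})). CORR_test \<epsilon> n p (X, y)} = {}"
    using assms by (auto simp: CORR_test_def CORR_def)
  show ?thesis unfolding empty by simp
next
  case False
  let ?M = "std_gaussian ({..<n} \<times> {..<p})"
  interpret prob_space ?M by (rule prob_space_std_gaussian)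
  let ?t = "corr_threshold \<epsilon> p"
  let ?s = "L2_set y {..<n}"
  let ?E = "\<lambda>j. {X \<in> space ?M. ?t * ?s \<le> \<bar>\<Sum>i<n. y i * X (i, j)\<bar>}"
  have "0 < ?s" using False L2_set_nonneg[of y "{..<n}"] by linarith
  have "?s\<^sup>2 = (\<Sum>i<n. (y i)\<^sup>2)" by (simp add: L2_set_def sum_nonneg)
  then have pos: "0 < (\<Sum>i<n. (y i)\<^sup>2)" using \<open>0 < ?s\<close> by (metis zero_less_power)
  \<comment> \<open>The Gaussian family is indexed by matrix positions, so column \<open>j\<close>
    is first treated as a set of positions.\<close>
  have column: "(\<Sum>k\<in>{..<n} \<times> {j}. f k) = (\<Sum>i<n. f (i, j))" for f :: "nat \<times> nat \<Rightarrow> real" and j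
  proof -
    have "{..<n} \<times> {j} = (\<lambda>i. (i, j)) ` {..<n}" by auto
    then show ?thesis by (simp add: sum.reindex inj_on_def)
  qed
  have tail: "prob (?E j) \<le> 2 * exp (- ?t\<^sup>2 / 2)" if j: "j < p" for j
  proof -
    have "distributed ?M lborel (\<lambda>X. \<Sum>k\<in>{..<n} \<times> {j}. y (fst k) * X k)
        (normal_density 0 (sqrt (\<Sum>k\<in>{..<n} \<times> {j}. (y (fst k))\<^sup>2)))"
    proof (rule normal_linear_combination)
      show "indep_vars (\<lambda>_. borel) (\<lambda>k X. X k) ({..<n} \<times> {j})"
        using j by (intro indep_vars_subset[OF indep_vars_std_gaussian]) auto
      show "distributed ?M lborel (\<lambda>X. X k) std_normal_density" if "k \<in> {..<n} \<times> {j}" for k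
        using that j by (intro distributed_std_gaussian) auto
    qed (use pos in \<open>simp_all add: column\<close>)
    then have "distributed ?M lborel (\<lambda>X. \<Sum>i<n. y i * X (i, j)) (normal_density 0 ?s)"
      by (simp add: column L2_set_def)
    then show ?thesis
      using assms \<open>0 < ?s\<close> by (intro centered_normal_tail) auto
  qed
  have "{X \<in> space ?M. CORR_test \<epsilon> n p (X, y)} \<subseteq> (\<Union>j\<in>{..<p}. ?E j)"
    using \<open>0 < ?s\<close> by (auto simp: CORR_test_def CORR_def field_simps)
  moreover have E: "?E j \<in> events" if "j < p" for j
  proof -
    have [measurable]: "(\<lambda>X. X (i, j)) \<in> borel_measurable ?M" if "i < n" for i
      using that \<open>j < p\<close> distributed_std_gaussian[of "(i, j)" "{..<n} \<times> {..<p}"]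
      by (simp add: distributed_def)
    show ?thesis by measurable
  qed
  ultimately have "prob {X \<in> space ?M. CORR_test \<epsilon> n p (X, y)} \<le> prob (\<Union>j\<in>{..<p}. ?E j)"
    by (intro finite_measure_mono) auto
  also have "\<dots> \<le> (\<Sum>j<p. prob (?E j))"
    using E by (intro finite_measure_subadditive_finite) auto
  also have "\<dots> \<le> real p * (2 * exp (- ?t\<^sup>2 / 2))"
    using sum_bounded_above[of "{..<p}" "\<lambda>j. prob (?E j)", OF tail] by simp
  finally show ?thesis .
qed

text \<open>On the stacked array, outside the deviation event \<open>bad\<close>,
  \<open>normalized_correlation_ge\<close> lifts column \<open>l\<close> over the threshold. A miss
  therefore maps into \<open>bad\<close>, whose probability \<open>regression_concentration\<close>
  bounds.\<close>

lemma CORR_test_fixed_signal: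
  fixes \<beta> :: "nat \<Rightarrow> real"
  assumes "0 < n" "0 < \<sigma>" and l: "l < p" "\<beta> l \<noteq> 0" and "0 \<le> corr_threshold \<epsilon> p"
  defines "v \<equiv> (L2_set \<beta> {..<p})\<^sup>2 / \<sigma>\<^sup>2 + 1" and "a \<equiv> \<beta> l / \<sigma>"
  assumes t: "32 * (corr_threshold \<epsilon> p)\<^sup>2 * v \<le> 9 * real n * a\<^sup>2"
  shows "measure (std_gaussian ({..<n} \<times> {..<p}) \<Otimes>\<^sub>M std_gaussian {..<n})
    {(X, w) \<in> space (std_gaussian ({..<n} \<times> {..<p}) \<Otimes>\<^sub>M std_gaussian {..<n}).
      \<not> CORR_test \<epsilon> n p (X, \<lambda>i\<in>{..<n}. 1 / \<sigma> * (\<Sum>j<p. X (i, j) * \<beta> j) + w i)}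
    \<le> 3 / real n + 48 * v / (real n * a\<^sup>2)"
  (is "measure ?G ?miss \<le> _")
proof -
  let ?K = "{..<n} \<times> {..p}"
  let ?f = "\<lambda>(X, w). \<lambda>k\<in>?K. if snd k < p then X k else w (fst k) :: real"
  interpret K: prob_space "std_gaussian ?K" by (rule prob_space_std_gaussian)
  interpret X: prob_space "std_gaussian ({..<n} \<times> {..<p})" by (rule prob_space_std_gaussian)
  interpret w: prob_space "std_gaussian {..<n}" by (rule prob_space_std_gaussian)
  interpret G: pair_prob_space "std_gaussian ({..<n} \<times> {..<p})" "std_gaussian {..<n}" ..
  \<comment> \<open>The coefficient 1 at index \<open>p\<close> picks up the noise, so
    \<open>Y Z i\<close> is the response in row \<open>i\<close>.\<close>
  define c where "c j = (if j < p then \<beta> j / \<sigma> else 1)" for j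
  define Y :: "(nat \<times> nat \<Rightarrow> real) \<Rightarrow> nat \<Rightarrow> real" where "Y Z i = (\<Sum>j\<le>p. c j * Z (i, j))" for Z i
  define bad where "bad = {Z \<in> space (std_gaussian ?K).
      real n * v \<le> \<bar>(\<Sum>i<n. (Y Z i)\<^sup>2) - real n * v\<bar> \<or>
      real n * \<bar>a\<bar> / 4 \<le> \<bar>(\<Sum>i<n. Z (i, l) * Y Z i) - real n * a\<bar>}"
  have cl: "c l = a" using l by (simp add: c_def a_def)
  have "a \<noteq> 0" using l \<open>0 < \<sigma>\<close> by (simp add: a_def)
  \<comment> \<open>The signal coefficients contribute the SNR and the noise column the summand
    1.\<close>
  have v: "(\<Sum>j\<le>p. (c j)\<^sup>2) = v"
    by (simp add: v_def c_def L2_set_def sum_nonneg power_divide sum_divide_distrib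
        flip: lessThan_Suc_atMost)
  have "0 < v" by (simp add: v_def add_nonneg_pos)
  have f: "?f \<in> measurable ?G (std_gaussian ?K)"
  proof -
    have 1: "(\<lambda>X. X k) \<in> borel_measurable (std_gaussian I)" if "k \<in> I" for k :: 'k and I
      using distributed_std_gaussian[OF that] by (simp add: distributed_def)
    have "?f \<in> measurable ?G (vec_space ?K)"
      unfolding split_beta'
    proof (intro measurable_restrict)
      fix k assume k: "k \<in> ?K"
      show "(\<lambda>x. if snd k < p then fst x k else snd x (fst k)) \<in> borel_measurable ?G"
      proof (cases "snd k < p")
        case True
        then show ?thesis using measurable_compose[OF measurable_fst 1, of k] k by auto
      next
        case False
        then show ?thesis using measurable_compose[OF measurable_snd 1, of "fst k"] k by auto
      qed
    qed
    then show ?thesis by (simp add: measurable_cong_sets[OF refl sets_std_gaussian])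
  qed
  have bad: "bad \<in> sets (std_gaussian ?K)"
  proof -
    have [measurable]: "(\<lambda>Z. Z k) \<in> borel_measurable (std_gaussian ?K)" if "k \<in> ?K" for k
      using distributed_std_gaussian[OF that] by (simp add: distributed_def)
    have [measurable]: "(\<lambda>Z. Y Z i) \<in> borel_measurable (std_gaussian ?K)" if "i < n" for i
      unfolding Y_def using that by (intro borel_measurable_sum borel_measurable_times) auto
    have [measurable]: "(\<lambda>Z. \<Sum>i<n. Z (i, l) * Y Z i) \<in> borel_measurable (std_gaussian ?K)"
      using l by (intro borel_measurable_sum borel_measurable_times) auto
    show ?thesis unfolding bad_def by measurable
  qed
  have "?miss \<subseteq> ?f -` bad \<inter> space ?G"
  proof
    fix z assume z: "z \<in> ?miss"
    obtain X w where Xw: "z = (X, w)" by (cases z)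
    with z have sp: "(X, w) \<in> space ?G"
      and miss: "\<not> CORR_test \<epsilon> n p (X, \<lambda>i\<in>{..<n}. 1 / \<sigma> * (\<Sum>j<p. X (i, j) * \<beta> j) + w i)"
      by auto
    let ?Z = "?f (X, w)"
    have Y: "Y ?Z i = 1 / \<sigma> * (\<Sum>j<p. X (i, j) * \<beta> j) + w i" if "i < n" for i
      using that by (simp add: Y_def c_def sum_distrib_left mult_ac flip: lessThan_Suc_atMost)
    have Zl: "?Z (i, l) = X (i, l)" if "i < n" for i
      using that l by simp
    have "?Z \<in> space (std_gaussian ?K)"
      using measurable_space[OF f sp] .
    moreover have False if "?Z \<in> space (std_gaussian ?K)" "?Z \<notin> bad"
    proof -
      have "corr_threshold \<epsilon> p \<le> \<bar>\<Sum>i<n. ?Z (i, l) * Y ?Z i\<bar> / sqrt (\<Sum>i<n. (Y ?Z i)\<^sup>2)"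
        using that assms(1,5) \<open>0 < v\<close> \<open>a \<noteq> 0\<close> t
        by (intro normalized_correlation_ge[of "real n" v a]) (auto simp: bad_def not_le)
      also have "\<dots> = \<bar>\<Sum>i<n. X (i, l) * (1 / \<sigma> * (\<Sum>j<p. X (i, j) * \<beta> j) + w i)\<bar> /
          sqrt (\<Sum>i<n. (1 / \<sigma> * (\<Sum>j<p. X (i, j) * \<beta> j) + w i)\<^sup>2)"
        using Y Zl by (intro arg_cong2[where f = "(/)"] arg_cong[where f = abs]
          arg_cong[where f = sqrt] sum.cong) (simp_all del: split_conv)
      finally show False
        using miss l(1) by (auto simp: CORR_test_def CORR_def L2_set_def)
    qed
    ultimately have "?Z \<in> bad" by blast
    then show "z \<in> ?f -` bad \<inter> space ?G"
      using sp unfolding Xw by blast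
  qed
  then have "measure ?G ?miss \<le> measure ?G (?f -` bad \<inter> space ?G)"
    using f bad by (intro G.finite_measure_mono) (auto intro: measurable_sets)
  also have "\<dots> = measure (distr ?G (std_gaussian ?K) ?f) bad"
    using f bad by (simp add: measure_distr)
  also have "\<dots> = measure (std_gaussian ?K) bad"
    by (simp only: distr_design_noise)
  also have "\<dots> \<le> 3 / real n + 48 * v / (real n * a\<^sup>2)"
    using K.regression_concentration[of "{..<n}" "{..p}" "\<lambda>k Z. Z k" l c, OF _ _ _
        indep_vars_std_gaussian distributed_std_gaussian] assms(1) l \<open>a \<noteq> 0\<close>
    unfolding bad_def Y_def by (simp add: cl v lessThan_empty_iff)
  finally show ?thesis .
qed

section \<open>Conditioning on one component of a product measure\<close>

lemma (in pair_prob_space) measure_le_of_sections_snd: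
  assumes A: "A \<in> sets (M1 \<Otimes>\<^sub>M M2)" and "0 \<le> c"
    and le: "\<And>y. y \<in> space M2 \<Longrightarrow> measure M1 ((\<lambda>x. (x, y)) -` A) \<le> c"
  shows "measure (M1 \<Otimes>\<^sub>M M2) A \<le> c"
proof -
  have "emeasure (M1 \<Otimes>\<^sub>M M2) A = (\<integral>\<^sup>+y. emeasure M1 ((\<lambda>x. (x, y)) -` A) \<partial>M2)"
    by (rule emeasure_pair_measure_alt2[OF A])
  also have "\<dots> \<le> (\<integral>\<^sup>+y. ennreal c \<partial>M2)"
    using le by (intro nn_integral_mono) (simp add: M1.emeasure_eq_measure ennreal_leI)
  also have "\<dots> = ennreal c"
    by (simp add: M2.emeasure_space_1)
  finally show ?thesis
    using \<open>0 \<le> c\<close> by (simp add: emeasure_eq_measure)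
qed

text \<open>Tonelli in the other order. Almost every section suffices here, since the bound on a
  miss is known only for signals in the set that carries the prior.\<close>

lemma (in pair_prob_space) measure_le_of_sections_fst:
  assumes A: "A \<in> sets (M1 \<Otimes>\<^sub>M M2)" and "0 \<le> c"
    and le: "AE x in M1. measure M2 (Pair x -` A) \<le> c"
  shows "measure (M1 \<Otimes>\<^sub>M M2) A \<le> c"
proof -
  have "emeasure (M1 \<Otimes>\<^sub>M M2) A = (\<integral>\<^sup>+x. emeasure M2 (Pair x -` A) \<partial>M1)"
    by (rule M2.emeasure_pair_measure_alt[OF A])
  also have "\<dots> \<le> (\<integral>\<^sup>+x. ennreal c \<partial>M1)"
    using le by (intro nn_integral_mono_AE) (auto simp: M2.emeasure_eq_measure ennreal_leI)
  also have "\<dots> = ennreal c"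
    by (simp add: M1.emeasure_space_1)
  finally show ?thesis
    using \<open>0 \<le> c\<close> by (simp add: emeasure_eq_measure)
qed

subsection \<open>Averaging over the signal and the noise\<close>

lemma hausdorff_empty: "hausdorff p s {} = 0"
  using hausdorff_finite_le[of "{}" p s] by (simp split: if_splits)

lemma uniform_on_space:
  assumes "uniform_on p S P"
  shows "space P = {..<p} \<rightarrow>\<^sub>E UNIV"
  using assms sets_eq_imp_space_eq[of P "vec_space {..<p}"] by (simp add: uniform_on_def space_PiM)

text \<open>The normaliser \<open>hausdorff p s S\<close> is neither 0 nor infinite, so its quotient
  by itself is 1.\<close>

lemma prob_space_uniform_on:
  assumes P: "uniform_on p S P" and "S \<subseteq> {..<p} \<rightarrow>\<^sub>E UNIV"
  shows "prob_space P"
proof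
  have "space P \<in> sets (vec_space {..<p})"
    using P sets.top[of P] by (simp add: uniform_on_def)
  moreover have "space P \<inter> S = S"
    using assms uniform_on_space[OF P] by auto
  ultimately show "emeasure P (space P) = 1"
    using P by (auto simp: uniform_on_def less_top)
qed

text \<open>
  \<open>S\<close> need not be measurable (the alphabet is arbitrary), so the conclusion cannot be obtained
  from \<open>AE \<beta> in P. \<beta> \<in> S\<close>.
\<close>

lemma AE_uniform_on:
  assumes P: "uniform_on p S P" and Q: "Measurable.pred P Q" and "\<And>\<beta>. \<beta> \<in> S \<Longrightarrow> Q \<beta>"
  shows "AE \<beta> in P. Q \<beta>"
proof (rule AE_I)
  have *: "{\<beta> \<in> space P. \<not> Q \<beta>} \<in> sets P" using Q by measurable
  \<comment> \<open>The exceptional set is measurable and misses \<open>S\<close>, so the formula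
    for \<open>P\<close> gives it the Hausdorff measure of the empty set.\<close>
  have "{\<beta> \<in> space P. \<not> Q \<beta>} \<inter> S = {}" using assms(3) by auto
  then show "emeasure P {\<beta> \<in> space P. \<not> Q \<beta>} = 0"
    using P * by (auto simp: uniform_on_def hausdorff_empty)
  show "{\<beta> \<in> space P. \<not> Q \<beta>} \<in> sets P" by (rule *)
qed auto

text \<open>Given the noise, the response is a fixed vector, and
  \<open>CORR_test_fixed_response\<close> is uniform in that vector; the scaling of the noise thus
  disappears from the bound.\<close>

lemma slr_null_acceptance:
  assumes "0 < corr_threshold \<epsilon> p"
  shows "measure (slr_null n p r \<sigma>) {z \<in> space (slr_null n p r \<sigma>). \<not> CORR_test \<epsilon> n p z}
    \<in> {1 - real p * (2 * exp (- (corr_threshold \<epsilon> p)\<^sup>2 / 2))..1}"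
proof -
  let ?GX = "std_gaussian ({..<n} \<times> {..<p})" and ?Gw = "std_gaussian {..<n}"
  let ?V = "vec_space ({..<n} \<times> {..<p}) \<Otimes>\<^sub>M vec_space {..<n}"
  let ?f = "\<lambda>(X, w). (X, \<lambda>i\<in>{..<n}. sqrt (r\<^sup>2 / \<sigma>\<^sup>2 + 1) * w i)"
  let ?c = "real p * (2 * exp (- (corr_threshold \<epsilon> p)\<^sup>2 / 2))"
  interpret X: prob_space ?GX by (rule prob_space_std_gaussian)
  interpret w: prob_space ?Gw by (rule prob_space_std_gaussian)
  interpret G: pair_prob_space ?GX ?Gw ..
  have f [measurable]: "?f \<in> measurable (?GX \<Otimes>\<^sub>M ?Gw) ?V"
    by measurable
  interpret null: prob_space "slr_null n p r \<sigma>"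
    unfolding slr_null_def by (rule G.prob_space_distr[OF f])
  have [measurable]: "Measurable.pred (slr_null n p r \<sigma>) (CORR_test \<epsilon> n p)"
    by (simp add: slr_null_def)
  have "null.prob {z \<in> space (slr_null n p r \<sigma>). CORR_test \<epsilon> n p z} =
      measure (?GX \<Otimes>\<^sub>M ?Gw) {x \<in> space (?GX \<Otimes>\<^sub>M ?Gw). CORR_test \<epsilon> n p (?f x)}"
    unfolding slr_null_def using measurable_space[OF f]
    by (subst measure_distr) (auto intro!: arg_cong2[where f = measure])
  also have "\<dots> \<le> ?c"
  proof (rule G.measure_le_of_sections_snd)
    show "{x \<in> space (?GX \<Otimes>\<^sub>M ?Gw). CORR_test \<epsilon> n p (?f x)} \<in> sets (?GX \<Otimes>\<^sub>M ?Gw)"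
      by measurable
    fix w assume "w \<in> space ?Gw"
    then have "(\<lambda>X. (X, w)) -` {x \<in> space (?GX \<Otimes>\<^sub>M ?Gw). CORR_test \<epsilon> n p (?f x)} =
        {X \<in> space ?GX. CORR_test \<epsilon> n p (X, \<lambda>i\<in>{..<n}. sqrt (r\<^sup>2 / \<sigma>\<^sup>2 + 1) * w i)}"
      by (auto simp: space_pair_measure)
    then show "X.prob ((\<lambda>X. (X, w)) -` {x \<in> space (?GX \<Otimes>\<^sub>M ?Gw). CORR_test \<epsilon> n p (?f x)}) \<le> ?c"
      using CORR_test_fixed_response[OF assms] by simp
  qed simp
  finally show ?thesis
    using null.prob_neg[of "CORR_test \<epsilon> n p"] by simp
qed

text \<open>Conditioning on the signal: a miss probability of at most \<open>c\<close> for each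
  signal in \<open>S\<close> survives averaging over the prior.\<close>

lemma slr_alt_rejection:
  assumes P: "uniform_on p S P" and S: "S \<subseteq> {..<p} \<rightarrow>\<^sub>E UNIV" and "0 \<le> c"
    and miss: "\<And>\<beta>. \<beta> \<in> S \<Longrightarrow> measure (std_gaussian ({..<n} \<times> {..<p}) \<Otimes>\<^sub>M std_gaussian {..<n})
      {(X, w) \<in> space (std_gaussian ({..<n} \<times> {..<p}) \<Otimes>\<^sub>M std_gaussian {..<n}).
        \<not> CORR_test \<epsilon> n p (X, \<lambda>i\<in>{..<n}. 1 / \<sigma> * (\<Sum>j<p. X (i, j) * \<beta> j) + w i)} \<le> c"
  shows "measure (slr_alt n p \<sigma> P) {z \<in> space (slr_alt n p \<sigma> P). CORR_test \<epsilon> n p z} \<in> {1 - c..1}"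
proof -
  let ?G = "std_gaussian ({..<n} \<times> {..<p}) \<Otimes>\<^sub>M std_gaussian {..<n}"
  let ?V = "vec_space ({..<n} \<times> {..<p}) \<Otimes>\<^sub>M vec_space {..<n}"
  let ?f = "\<lambda>(\<beta>, X, w). (X, \<lambda>i\<in>{..<n}. 1 / \<sigma> * (\<Sum>j<p. X (i, j) * \<beta> j) + w i)"
  interpret P: prob_space P by (rule prob_space_uniform_on[OF P S])
  interpret X: prob_space "std_gaussian ({..<n} \<times> {..<p})" by (rule prob_space_std_gaussian)
  interpret w: prob_space "std_gaussian {..<n}" by (rule prob_space_std_gaussian)
  interpret G: pair_prob_space "std_gaussian ({..<n} \<times> {..<p})" "std_gaussian {..<n}" ..
  interpret PG: pair_prob_space P ?G ..
  have sets_P [measurable_cong]: "sets P = sets (vec_space {..<p})"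
    using P by (simp add: uniform_on_def)
  have f [measurable]: "?f \<in> measurable (P \<Otimes>\<^sub>M ?G) ?V"
  proof -
    have [measurable]: "(\<lambda>x. fst (snd x) (i, j)) \<in> borel_measurable (P \<Otimes>\<^sub>M ?G)" if "i < n" "j < p" for i j
      using that by (intro measurable_compose[OF measurable_snd] measurable_compose[OF measurable_fst])
        (simp add: measurable_component_singleton measurable_cong_sets[OF sets_std_gaussian refl])
    have [measurable]: "(\<lambda>x. snd (snd x) i) \<in> borel_measurable (P \<Otimes>\<^sub>M ?G)" if "i < n" for i
      using that by (intro measurable_compose[OF measurable_snd])
        (simp add: measurable_component_singleton measurable_cong_sets[OF sets_std_gaussian refl])
    have [measurable]: "(\<lambda>x. fst x j) \<in> borel_measurable (P \<Otimes>\<^sub>M ?G)" if "j < p" for j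
      using that by (intro measurable_compose[OF measurable_fst])
        (simp add: measurable_component_singleton measurable_cong_sets[OF sets_P refl])
    show ?thesis
      unfolding split_beta' by measurable
  qed
  interpret alt: prob_space "slr_alt n p \<sigma> P"
    unfolding slr_alt_def by (rule PG.prob_space_distr[OF f])
  have [measurable]: "Measurable.pred (slr_alt n p \<sigma> P) (CORR_test \<epsilon> n p)"
    by (simp add: slr_alt_def)
  let ?A = "{x \<in> space (P \<Otimes>\<^sub>M ?G). \<not> CORR_test \<epsilon> n p (?f x)}"
  have A: "?A \<in> sets (P \<Otimes>\<^sub>M ?G)" by measurable
  have "alt.prob {z \<in> space (slr_alt n p \<sigma> P). \<not> CORR_test \<epsilon> n p z} = measure (P \<Otimes>\<^sub>M ?G) ?A"
    unfolding slr_alt_def using measurable_space[OF f]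
    by (subst measure_distr) (auto intro!: arg_cong2[where f = measure])
  also have "\<dots> \<le> c"
  proof (rule PG.measure_le_of_sections_fst[OF A \<open>0 \<le> c\<close>], rule AE_uniform_on[OF P])
    \<comment> \<open>\<open>AE_uniform_on\<close> requires the miss probability to depend
      measurably on the signal.\<close>
    show "Measurable.pred P (\<lambda>\<beta>. G.prob (Pair \<beta> -` ?A) \<le> c)"
      using G.measurable_emeasure_Pair[OF A] by (simp add: measure_def)
    fix \<beta> assume \<beta>: "\<beta> \<in> S"
    then have "\<beta> \<in> space P" using S uniform_on_space[OF P] by auto
    then have "Pair \<beta> -` ?A = {(X, w) \<in> space ?G.
        \<not> CORR_test \<epsilon> n p (X, \<lambda>i\<in>{..<n}. 1 / \<sigma> * (\<Sum>j<p. X (i, j) * \<beta> j) + w i)}"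
      by (auto simp: space_pair_measure)
    then show "G.prob (Pair \<beta> -` ?A) \<le> c"
      using miss[OF \<beta>] by simp
  qed
  finally show ?thesis
    using alt.prob_neg[of "CORR_test \<epsilon> n p"] by simp
qed

section \<open>From the sample size to explicit error bounds\<close>

lemma sparse_vectors_entry:
  assumes "\<beta> \<in> sparse_vectors p k D r" and "0 < k"
  obtains l where "l < p" "\<beta> l \<noteq> 0" "\<beta> l \<in> D" "L2_set \<beta> {..<p} = r"
proof -
  have "card {j \<in> {..<p}. \<beta> j \<noteq> 0} \<noteq> 0"
    using assms by (simp add: sparse_vectors_def)
  then have "{j \<in> {..<p}. \<beta> j \<noteq> 0} \<noteq> {}"
    by (metis card.empty)
  then obtain l where "l < p" "\<beta> l \<noteq> 0" by blast
  then show ?thesis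
    using that assms(1) by (simp add: sparse_vectors_def)
qed

lemma beta_min_le: "b \<in> D \<Longrightarrow> beta_min D \<le> \<bar>b\<bar>"
  unfolding beta_min_def by (intro cInf_lower bdd_belowI[of _ 0]) auto

lemma corr_threshold_sq:
  assumes "0 < \<epsilon>" "0 < p"
  shows "0 < corr_threshold \<epsilon> p" "(corr_threshold \<epsilon> p)\<^sup>2 = 2 * (1 + \<epsilon> / 2) * ln (2 * real p)"
proof -
  have "0 < ln (2 * real p)" using assms by (intro ln_gt_zero) simp
  then show "0 < corr_threshold \<epsilon> p" "(corr_threshold \<epsilon> p)\<^sup>2 = 2 * (1 + \<epsilon> / 2) * ln (2 * real p)"
    using assms by (simp_all add: corr_threshold_def)
qed

text \<open>Since \<open>r^2 (SNR + 1) / SNR = \<sigma>^2 (SNR + 1)\<close>, the sample size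
  condition bounds \<open>n (m / \<sigma>)^2\<close> from below, and passing from \<open>m\<close>
  to \<open>|b|\<close> only enlarges that quantity.\<close>

lemma signal_to_noise_bound:
  fixes n b r \<sigma> \<epsilon> L m :: real
  assumes "0 < \<sigma>" "0 < r" "0 < m" "m \<le> \<bar>b\<bar>" "0 < L" "0 < \<epsilon>"
    and n: "n \<ge> 8 * (1 + \<epsilon>) / m\<^sup>2 * r\<^sup>2 * ((SNR r \<sigma> + 1) / SNR r \<sigma>) * L"
  shows "8 * (1 + \<epsilon>) * L * (r\<^sup>2 / \<sigma>\<^sup>2 + 1) \<le> n * (b / \<sigma>)\<^sup>2"
proof -
  have "8 * (1 + \<epsilon>) / m\<^sup>2 * r\<^sup>2 * ((SNR r \<sigma> + 1) / SNR r \<sigma>) * L =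
      8 * (1 + \<epsilon>) * L * (r\<^sup>2 / \<sigma>\<^sup>2 + 1) / (m / \<sigma>)\<^sup>2"
    using assms by (simp add: SNR_def field_simps)
  with n have "8 * (1 + \<epsilon>) * L * (r\<^sup>2 / \<sigma>\<^sup>2 + 1) \<le> n * (m / \<sigma>)\<^sup>2"
    using assms by (simp add: pos_divide_le_eq)
  also have "\<dots> \<le> n * (b / \<sigma>)\<^sup>2"
  proof (intro mult_left_mono)
    have "m\<^sup>2 \<le> b\<^sup>2" using assms by (metis abs_le_square_iff abs_of_pos)
    then show "(m / \<sigma>)\<^sup>2 \<le> (b / \<sigma>)\<^sup>2"
      by (simp add: power_divide divide_right_mono)
    have "0 \<le> 8 * (1 + \<epsilon>) / m\<^sup>2 * r\<^sup>2 * ((SNR r \<sigma> + 1) / SNR r \<sigma>) * L"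
      using assms by (simp add: SNR_def)
    then show "0 \<le> n" using n by linarith
  qed
  finally show ?thesis .
qed

text \<open>The sample size enters twice, both times through \<open>snr\<close>: it brings the
  signal column over the threshold, and it reduces the Chebyshev error of the correlation to
  \<open>6 / ln (2 p)\<close>.\<close>

lemma slr_alt_detection:
  assumes "0 < \<epsilon>" "0 < \<sigma>" "0 < k" "0 < p" "0 < n" "0 < beta_min D"
    and P: "signal_prior p k D r P"
    and n: "real n \<ge> 8 * (1 + \<epsilon>) / (beta_min D)\<^sup>2 * r\<^sup>2 * ((SNR r \<sigma> + 1) / SNR r \<sigma>) * ln (2 * real p)"
  shows "measure (slr_alt n p \<sigma> P) {z \<in> space (slr_alt n p \<sigma> P). CORR_test \<epsilon> n p z}
    \<in> {1 - (3 / real n + 6 / ln (2 * real p))..1}"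
proof (rule slr_alt_rejection)
  let ?L = "ln (2 * real p)"
  let ?G = "std_gaussian ({..<n} \<times> {..<p}) \<Otimes>\<^sub>M std_gaussian {..<n}"
  show "uniform_on p (sparse_vectors p k D r) P"
    using P by (simp add: signal_prior_def)
  show "sparse_vectors p k D r \<subseteq> {..<p} \<rightarrow>\<^sub>E UNIV"
    by (auto simp: sparse_vectors_def)
  have L: "0 < ?L" using \<open>0 < p\<close> by (intro ln_gt_zero) simp
  then show "0 \<le> 3 / real n + 6 / ?L" by simp
  fix \<beta> assume "\<beta> \<in> sparse_vectors p k D r"
  then obtain l where l: "l < p" "\<beta> l \<noteq> 0" "\<beta> l \<in> D" and r: "L2_set \<beta> {..<p} = r"
    using \<open>0 < k\<close> by (rule sparse_vectors_entry)
  \<comment> \<open>Passing to absolute values leaves the norm unchanged and lets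
    \<open>member_le_L2_set\<close> bound \<open>|\<beta> l|\<close>. The resulting
    \<open>0 < r\<close> keeps the SNR away from 0.\<close>
  have "\<bar>\<beta> l\<bar> \<le> r"
    using member_le_L2_set[of "{..<p}" l "\<lambda>j. \<bar>\<beta> j\<bar>"] l r by (simp add: L2_set_def)
  then have "0 < r" using l by linarith
  let ?v = "r\<^sup>2 / \<sigma>\<^sup>2 + 1" and ?a = "\<beta> l / \<sigma>"
  have "0 < ?v" by (simp add: add_nonneg_pos)
  have snr: "8 * (1 + \<epsilon>) * ?L * ?v \<le> real n * ?a\<^sup>2"
    by (rule signal_to_noise_bound[OF \<open>0 < \<sigma>\<close> \<open>0 < r\<close> \<open>0 < beta_min D\<close> beta_min_le[OF l(3)] L \<open>0 < \<epsilon>\<close> n])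
  \<comment> \<open>The factor \<open>64 + 32 \<epsilon>\<close> on the threshold side stays below
    the \<open>72 + 72 \<epsilon>\<close> that nine times \<open>snr\<close> provides.\<close>
  have "32 * (corr_threshold \<epsilon> p)\<^sup>2 * ?v = 8 * (8 + 4 * \<epsilon>) * ?L * ?v"
    using corr_threshold_sq(2)[OF \<open>0 < \<epsilon>\<close> \<open>0 < p\<close>] by (simp add: algebra_simps)
  also have "\<dots> \<le> 9 * (8 * (1 + \<epsilon>) * ?L * ?v)"
  proof -
    have "8 * (8 + 4 * \<epsilon>) * (?L * ?v) \<le> 9 * (8 * (1 + \<epsilon>)) * (?L * ?v)"
      using \<open>0 < \<epsilon>\<close> L \<open>0 < ?v\<close> by (intro mult_right_mono) auto
    then show ?thesis by (simp only: mult.assoc)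
  qed
  also have "\<dots> \<le> 9 * real n * ?a\<^sup>2"
    using snr by simp
  finally have t: "32 * (corr_threshold \<epsilon> p)\<^sup>2 * ?v \<le> 9 * real n * ?a\<^sup>2" .
  have "measure ?G {(X, w) \<in> space ?G.
      \<not> CORR_test \<epsilon> n p (X, \<lambda>i\<in>{..<n}. 1 / \<sigma> * (\<Sum>j<p. X (i, j) * \<beta> j) + w i)}
    \<le> 3 / real n + 48 * ?v / (real n * ?a\<^sup>2)"
    using CORR_test_fixed_signal[where \<beta> = \<beta> and l = l and n = n and \<sigma> = \<sigma> and p = p and \<epsilon> = \<epsilon>]
      \<open>0 < n\<close> \<open>0 < \<sigma>\<close> l corr_threshold_sq(1)[OF \<open>0 < \<epsilon>\<close> \<open>0 < p\<close>]
      t r by simp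
  \<comment> \<open>Here the factor \<open>1 + \<epsilon>\<close> of \<open>snr\<close> is lowered
    to 1.\<close>
  also have "\<dots> \<le> 3 / real n + 48 * ?v / (8 * ?L * ?v)"
  proof (intro add_left_mono divide_left_mono)
    have "8 * 1 * (?L * ?v) \<le> 8 * (1 + \<epsilon>) * (?L * ?v)"
      using \<open>0 < \<epsilon>\<close> L \<open>0 < ?v\<close> by (intro mult_right_mono) auto
    then show "8 * ?L * ?v \<le> real n * ?a\<^sup>2" using snr by (simp add: mult.assoc)
    show "0 \<le> 48 * ?v" by simp
    show "0 < real n * ?a\<^sup>2 * (8 * ?L * ?v)"
      using \<open>0 < n\<close> \<open>0 < \<sigma>\<close> l(2) L \<open>0 < ?v\<close> by simp
  qed
  also have "48 * ?v / (8 * ?L * ?v) = 6 / ?L"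
    using \<open>0 < ?v\<close> by (subst nonzero_mult_divide_mult_cancel_right) simp_all
  finally show "measure ?G {(X, w) \<in> space ?G.
      \<not> CORR_test \<epsilon> n p (X, \<lambda>i\<in>{..<n}. 1 / \<sigma> * (\<Sum>j<p. X (i, j) * \<beta> j) + w i)}
    \<le> 3 / real n + 6 / ?L" .
qed

text \<open>With \<open>L = ln (2 p)\<close>, the union bound costs \<open>exp L\<close> and the
  tail gains \<open>exp (- (1 + \<epsilon> / 2) L)\<close>; what survives is the slack
  \<open>\<epsilon> / 2\<close> of the threshold.\<close>

lemma slr_null_detection:
  assumes "0 < \<epsilon>" "0 < p"
  shows "measure (slr_null n p r \<sigma>) {z \<in> space (slr_null n p r \<sigma>). \<not> CORR_test \<epsilon> n p z}
    \<in> {1 - (2 * real p) powr (- \<epsilon> / 2)..1}"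
proof -
  let ?L = "ln (2 * real p)"
  have "real p * (2 * exp (- (corr_threshold \<epsilon> p)\<^sup>2 / 2)) = exp ?L * exp (- ((1 + \<epsilon> / 2) * ?L))"
    using assms by (simp add: corr_threshold_sq)
  also have "\<dots> = exp (- \<epsilon> / 2 * ?L)"
    unfolding exp_add[symmetric] by (simp add: algebra_simps)
  also have "\<dots> = (2 * real p) powr (- \<epsilon> / 2)"
    using assms by (simp add: powr_def)
  finally show ?thesis
    using slr_null_acceptance[OF corr_threshold_sq(1)[OF assms], of n r \<sigma>] by simp
qed

text \<open>All parameters are sequences in \<open>p\<close>, and the prior is required for large
  \<open>p\<close> only: at \<open>p = 0\<close> no vector has a nonzero entry. That
  \<open>beta_min (D p)\<close> is itself the absolute value of an element makes the infimum an
  attained minimum. Both success probabilities are squeezed between explicit bounds and 1.\<close>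

theorem theorem2p9:
  fixes n k :: "nat \<Rightarrow> nat"
    and \<sigma> r :: "nat \<Rightarrow> real"
    and D :: "nat \<Rightarrow> real set"
    and P :: "nat \<Rightarrow> (nat \<Rightarrow> real) measure"
    and \<epsilon> :: real
  assumes "0 < \<epsilon>" and "\<epsilon> < 1"
    and "filterlim n at_top sequentially"
    and "(\<lambda>p. real (k p)) \<in> o(\<lambda>p. real p)"
    and "(\<lambda>p. real (n p)) \<in> \<omega>(\<lambda>p. real (k p))"
    and "\<And>p. 0 < \<sigma> p"
    and "\<And>p. beta_min (D p) \<in> abs ` D p" and "\<And>p. 0 < beta_min (D p)"
    and "\<forall>\<^sub>F p in sequentially. 0 < k p"
    and "\<forall>\<^sub>F p in sequentially. signal_prior p (k p) (D p) (r p) (P p)"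
    and "\<forall>\<^sub>F p in sequentially.
           real (n p) \<ge> 8 * (1 + \<epsilon>) / (beta_min (D p))\<^sup>2 * (r p)\<^sup>2 *
             ((SNR (r p) (\<sigma> p) + 1) / SNR (r p) (\<sigma> p)) * ln (2 * real p)"
  shows "strong_detection (\<lambda>p. slr_null (n p) p (r p) (\<sigma> p))
           (\<lambda>p. slr_alt (n p) p (\<sigma> p) (P p)) (\<lambda>p. CORR_test \<epsilon> (n p) p)"
  unfolding strong_detection_def
proof
  have p: "\<forall>\<^sub>F p :: nat in sequentially. 0 < p" by (rule eventually_gt_at_top)
  let ?null = "\<lambda>p. measure (slr_null (n p) p (r p) (\<sigma> p))
      {z \<in> space (slr_null (n p) p (r p) (\<sigma> p)). \<not> CORR_test \<epsilon> (n p) p z}"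
  have null: "\<forall>\<^sub>F p in sequentially. ?null p \<in> {1 - (2 * real p) powr (- \<epsilon> / 2)..1}"
    using p by eventually_elim (intro slr_null_detection assms(1))
  show "?null \<longlonglongrightarrow> 1"
  proof (rule tendsto_sandwich)
    show "(\<lambda>p. 1 - (2 * real p) powr (- \<epsilon> / 2)) \<longlonglongrightarrow> 1"
      using \<open>0 < \<epsilon>\<close> by real_asymp
    show "\<forall>\<^sub>F p in sequentially. 1 - (2 * real p) powr (- \<epsilon> / 2) \<le> ?null p"
      "\<forall>\<^sub>F p in sequentially. ?null p \<le> 1"
      using null by (auto elim: eventually_mono)
  qed simp
  let ?alt = "\<lambda>p. measure (slr_alt (n p) p (\<sigma> p) (P p))
      {z \<in> space (slr_alt (n p) p (\<sigma> p) (P p)). CORR_test \<epsilon> (n p) p z}"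
  \<comment> \<open>Without samples, \<open>3 / real (n p)\<close> would be 0 by convention and no
    error bound.\<close>
  have "\<forall>\<^sub>F p in sequentially. 0 < n p"
    using assms(3) eventually_gt_at_top by (rule eventually_compose_filterlim[rotated])
  then have alt: "\<forall>\<^sub>F p in sequentially. ?alt p \<in> {1 - (3 / real (n p) + 6 / ln (2 * real p))..1}"
    using p assms(9-11)
    by eventually_elim (rule slr_alt_detection[OF assms(1,6) _ _ _ assms(8)])
  show "?alt \<longlonglongrightarrow> 1"
  proof (rule tendsto_sandwich)
    have "(\<lambda>p. 3 / real (n p)) \<longlonglongrightarrow> 0"
      using assms(3) by (intro real_tendsto_divide_at_top[OF tendsto_const]
          filterlim_compose[OF filterlim_real_sequentially])
    moreover have "(\<lambda>p. 6 / ln (2 * real p)) \<longlonglongrightarrow> 0"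
      by real_asymp
    ultimately show "(\<lambda>p. 1 - (3 / real (n p) + 6 / ln (2 * real p))) \<longlonglongrightarrow> 1"
      using tendsto_diff[OF tendsto_const[of 1] tendsto_add] by force
    show "\<forall>\<^sub>F p in sequentially. 1 - (3 / real (n p) + 6 / ln (2 * real p)) \<le> ?alt p"
      "\<forall>\<^sub>F p in sequentially. ?alt p \<le> 1"
      using alt by (auto elim: eventually_mono)
  qed simp
qed

end
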